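(* Let $n\ge 2$ and let $A$ be a non-hermitian $n\times n$ quaternionic matrix with numerical range $W$; put $B=W\cap\mathbb{C}$, $B^-=W\cap\mathbb{C}^-$, $m=\min (W\cap\mathbb{R})$, $M=\max (W\cap\mathbb{R})$, $\pi_m=\min\pi_{\mathbb{R}}(W)$, $\pi_M=\max\pi_{\mathbb{R}}(W)$, where $\pi_{\mathbb{R}}:\mathbb{H}\to\mathbb{R}$ is the real-part projection. Let $y_m=\min\{y:(x,y)\in B\}$, and for $y\in[y_m,0]$ let $x_1(y)=\min\{x:(x,y)\in B^-\}$ and $x_2(y)=\max\{x:(x,y)\in B^-\}$. Let $a=x_1'(0^-)$, $b=x_2'(0^-)$ be the left derivatives at $0$, and let $l=\{(x,y): x=ay+m\}$ and $L=\{(x,y): x=by+M\}$. Suppose $\pi_m<m\le M<\pi_M$ and that there is $\tilde{\boldsymbol{\omega}}\in\mathbb{C}^+$ such that $l\cap L=\{\tilde{\boldsymbol{\omega}}\}$. Then $$\mathcal{C}(W)\cap\mathbb{C}=\mathrm{conv}\big\{(m,0),(M,0),\tilde{\boldsymbol{\omega}},\tilde{\boldsymbol{\omega}}^*\big\}\cap B,$$ where $\mathcal{C}(W)$ is the star-center of $W$.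
   Context: $\mathbb{H}$ is the real algebra of Hamilton quaternions with basis $1,i,j,k$, and $\mathbb{C}=\mathrm{span}_{\mathbb{R}}\{1,i\}\subset\mathbb{H}$, identified with $\mathbb{R}^2$ by writing $x+iy$ as $(x,y)$; $\mathbb{C}^+=\{y\ge 0\}$ and $\mathbb{C}^-=\{y\le 0\}$. The conjugate of $\boldsymbol{\omega}=(x,y)$ is $\boldsymbol{\omega}^*=(x,-y)$, and $\mathrm{conv}$ denotes convex hull. The numerical range of $A$ is $W=\{\boldsymbol{x}^*A\boldsymbol{x}:\boldsymbol{x}\in\mathbb{H}^n,\ |\boldsymbol{x}|=1\}$, where $\boldsymbol{x}^*$ is the conjugate transpose and $|\boldsymbol{x}|^2=\boldsymbol{x}^*\boldsymbol{x}$; $W\cap\mathbb{R}$ is nonempty. $A$ is hermitian if $A=A^*$; for non-hermitian $A$ one has $y_m<0$. $x_1$ is convex and $x_2$ is concave on $[y_m,0]$, with $x_1(0)=m$, $x_2(0)=M$, so the left derivatives at $0$ exist as extended real numbers ($a\in(-\infty,+\infty]$, $b\in[-\infty,+\infty)$); if a derivative is infinite, the convention $0\cdot(\pm\infty)=0$ is used (and $x$, $y$ are real) in the definitions of $l$ and $L$. The star-center of a set $S$ is $\mathcal{C}(S)=\{s_0\in S:(1-\alpha)s_0+\alpha s\in S\text{ for all } s\in S,\ \alpha\in[0,1]\}$. *)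

theory Defs
  imports "HOL-Analysis.Analysis"
begin

datatype quat = Quat (qRe: real) (qI: real) (qJ: real) (qK: real)

lemma quat_eqI: "qRe p = qRe q \<Longrightarrow> qI p = qI q \<Longrightarrow> qJ p = qJ q \<Longrightarrow> qK p = qK q \<Longrightarrow> p = q"
  by (rule quat.expand) simp

lemma quat_eq_iff: "p = q \<longleftrightarrow> qRe p = qRe q \<and> qI p = qI q \<and> qJ p = qJ q \<and> qK p = qK q"
  by (auto intro: quat_eqI)

instantiation quat :: ring_1
begin

definition zero_quat_def: "0 = Quat 0 0 0 0"
definition one_quat_def: "1 = Quat 1 0 0 0"
definition plus_quat_def:
  "p + q = Quat (qRe p + qRe q) (qI p + qI q) (qJ p + qJ q) (qK p + qK q)"
definition minus_quat_def:
  "p - q = Quat (qRe p - qRe q) (qI p - qI q) (qJ p - qJ q) (qK p - qK q)"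
definition uminus_quat_def: "- p = Quat (- qRe p) (- qI p) (- qJ p) (- qK p)"
definition times_quat_def:
  "p * q = Quat
     (qRe p * qRe q - qI p * qI q - qJ p * qJ q - qK p * qK q)
     (qRe p * qI q + qI p * qRe q + qJ p * qK q - qK p * qJ q)
     (qRe p * qJ q - qI p * qK q + qJ p * qRe q + qK p * qI q)
     (qRe p * qK q + qI p * qJ q - qJ p * qI q + qK p * qRe q)"

instance
  by standard
    (simp_all add: zero_quat_def one_quat_def plus_quat_def minus_quat_def uminus_quat_def
      times_quat_def quat_eq_iff algebra_simps)

end

lemma quat_ring_sel [simp]:
  "qRe 0 = 0" "qI 0 = 0" "qJ 0 = 0" "qK 0 = 0"
  "qRe 1 = 1" "qI 1 = 0" "qJ 1 = 0" "qK 1 = 0"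
  "qRe (p + q) = qRe p + qRe q" "qI (p + q) = qI p + qI q"
  "qJ (p + q) = qJ p + qJ q" "qK (p + q) = qK p + qK q"
  "qRe (p - q) = qRe p - qRe q" "qI (p - q) = qI p - qI q"
  "qJ (p - q) = qJ p - qJ q" "qK (p - q) = qK p - qK q"
  "qRe (- p) = - qRe p" "qI (- p) = - qI p" "qJ (- p) = - qJ p" "qK (- p) = - qK p"
  "qRe (p * q) = qRe p * qRe q - qI p * qI q - qJ p * qJ q - qK p * qK q"
  "qI (p * q) = qRe p * qI q + qI p * qRe q + qJ p * qK q - qK p * qJ q"
  "qJ (p * q) = qRe p * qJ q - qI p * qK q + qJ p * qRe q + qK p * qI q"
  "qK (p * q) = qRe p * qK q + qI p * qJ q - qJ p * qI q + qK p * qRe q"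
  by (simp_all add: zero_quat_def one_quat_def plus_quat_def minus_quat_def uminus_quat_def
      times_quat_def)

instantiation quat :: real_algebra_1
begin

definition scaleR_quat_def: "scaleR r q = Quat (r * qRe q) (r * qI q) (r * qJ q) (r * qK q)"

instance
  by standard (simp_all add: scaleR_quat_def quat_eq_iff algebra_simps)

end

lemma quat_scaleR_sel [simp]:
  "qRe (r *\<^sub>R q) = r * qRe q" "qI (r *\<^sub>R q) = r * qI q"
  "qJ (r *\<^sub>R q) = r * qJ q" "qK (r *\<^sub>R q) = r * qK q"
  by (simp_all add: scaleR_quat_def)

lemma quat_of_real_sel [simp]:
  "qRe (of_real r) = r" "qI (of_real r) = 0" "qJ (of_real r) = 0" "qK (of_real r) = 0"
  by (simp_all add: of_real_def)

instantiation quat :: real_inner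
begin

definition inner_quat_def:
  "inner p q = qRe p * qRe q + qI p * qI q + qJ p * qJ q + qK p * qK q"
definition norm_quat_def: "norm (q::quat) = sqrt (inner q q)"
definition sgn_quat_def: "sgn (q::quat) = q /\<^sub>R norm q"
definition dist_quat_def: "dist (p::quat) q = norm (p - q)"
definition uniformity_quat_def:
  "(uniformity :: (quat \<times> quat) filter) = (INF e\<in>{0<..}. principal {(x, y). dist x y < e})"
definition open_quat_def:
  "open (U::quat set) \<longleftrightarrow> (\<forall>x\<in>U. \<forall>\<^sub>F (x', y) in uniformity. x' = x \<longrightarrow> y \<in> U)"

instance
proof
  fix p q r :: quat and c :: real
  show "dist p q = norm (p - q)" by (fact dist_quat_def)
  show "sgn p = p /\<^sub>R norm p" by (fact sgn_quat_def)
  show "norm p = sqrt (inner p p)" by (fact norm_quat_def)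
  show "inner p q = inner q p" by (simp add: inner_quat_def mult.commute)
  show "inner (p + q) r = inner p r + inner q r" by (simp add: inner_quat_def distrib_right)
  show "inner (c *\<^sub>R p) q = c * inner p q" by (simp add: inner_quat_def distrib_left mult.assoc)
  show "0 \<le> inner p p" by (simp add: inner_quat_def)
  show "inner p p = 0 \<longleftrightarrow> p = 0"
  proof
    assume "inner p p = 0"
    then have "(qRe p)\<^sup>2 + (qI p)\<^sup>2 + ((qJ p)\<^sup>2 + (qK p)\<^sup>2) = 0"
      by (simp add: inner_quat_def power2_eq_square)
    then have "(qRe p)\<^sup>2 + (qI p)\<^sup>2 = 0" "(qJ p)\<^sup>2 + (qK p)\<^sup>2 = 0"
      by (simp_all add: add_nonneg_eq_0_iff)
    then show "p = 0" by (simp add: sum_power2_eq_zero_iff quat_eq_iff)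
  qed (simp add: inner_quat_def)
qed (fact uniformity_quat_def, fact open_quat_def)

end

instantiation quat :: euclidean_space
begin

definition Basis_quat_def:
  "Basis = {Quat 1 0 0 0, Quat 0 1 0 0, Quat 0 0 1 0, Quat 0 0 0 1}"

instance
proof
  fix u v :: quat
  show "(Basis :: quat set) \<noteq> {}" "finite (Basis :: quat set)"
    by (simp_all add: Basis_quat_def)
  show "inner u v = (if u = v then 1 else 0)" if "u \<in> Basis" "v \<in> Basis"
    using that unfolding Basis_quat_def by (elim insertE emptyE) (simp_all add: inner_quat_def)
  show "(\<forall>v\<in>Basis. inner u v = 0) \<longleftrightarrow> u = 0"
    unfolding quat_eq_iff[of u 0] by (simp add: Basis_quat_def inner_quat_def)
qed

end

definition qi :: quat where "qi = Quat 0 1 0 0"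
definition qj :: quat where "qj = Quat 0 0 1 0"
definition qk :: quat where "qk = Quat 0 0 0 1"

lemma hamilton_relations:
  "qi * qi = - 1" "qj * qj = - 1" "qk * qk = - 1"
  "qi * qj = qk" "qj * qk = qi" "qk * qi = qj"
  by (simp_all add: qi_def qj_def qk_def quat_eq_iff)

definition qcnj :: "quat \<Rightarrow> quat" where
  "qcnj q = Quat (qRe q) (- qI q) (- qJ q) (- qK q)"

definition cplane :: "quat set" where
  "cplane = span {1, qi}"

text \<open>The identification of \<open>(x, y)\<close> with \<open>x + i y\<close>.\<close>

definition cpt :: "real \<Rightarrow> real \<Rightarrow> quat" where
  "cpt x y = of_real x + qi * of_real y"

definition cplane_upper :: "quat set" where
  "cplane_upper = {cpt x y | x y. y \<ge> 0}"

definition cplane_lower :: "quat set" where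
  "cplane_lower = {cpt x y | x y. y \<le> 0}"

lemma cpt_eq_Quat: "cpt x y = Quat x y 0 0"
  by (simp add: cpt_def qi_def quat_eq_iff)

lemma qcnj_cpt: "qcnj (cpt x y) = cpt x (- y)"
  by (simp add: cpt_eq_Quat qcnj_def)

lemma cplane_eq: "cplane = {cpt x y | x y. True}"
proof -
  have mem: "q \<in> cplane \<longleftrightarrow> (\<exists>x y. q = x *\<^sub>R 1 + y *\<^sub>R qi)" for q
  proof -
    have "q \<in> cplane \<longleftrightarrow> (\<exists>x y. q - x *\<^sub>R 1 = y *\<^sub>R qi)"
      unfolding cplane_def span_insert span_singleton by auto
    then show ?thesis by (simp only: diff_eq_eq add.commute)
  qed
  have "x *\<^sub>R 1 + y *\<^sub>R qi = cpt x y" for x y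
    by (simp add: cpt_eq_Quat qi_def quat_eq_iff)
  with mem show ?thesis by auto
qed

definition cadjoint :: "quat^'n^'m \<Rightarrow> quat^'m^'n" where
  "cadjoint A = (\<chi> i j. qcnj (A $ j $ i))"

definition hermitian :: "quat^'n^'n \<Rightarrow> bool" where
  "hermitian A \<longleftrightarrow> A = cadjoint A"

definition star_prod :: "quat^'n \<Rightarrow> quat^'n \<Rightarrow> quat" where
  "star_prod x y = (\<Sum>i\<in>UNIV. qcnj (x $ i) * y $ i)"

text \<open>Since \<open>|x|\<^sup>2 = x\<^sup>* x\<close>, the condition \<open>|x| = 1\<close> reads \<open>x\<^sup>* x = 1\<close>.\<close>

definition numerical_range :: "quat^'n^'n \<Rightarrow> quat set" where
  "numerical_range A = {star_prod x (A *v x) | x. star_prod x x = 1}"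

lemma star_prod_self: "star_prod x x = of_real ((norm x)\<^sup>2)"
proof -
  have "qcnj q * q = of_real ((norm q)\<^sup>2)" for q
    by (simp add: qcnj_def norm_quat_def inner_quat_def quat_eq_iff)
  then have "star_prod x x = (\<Sum>i\<in>UNIV. of_real ((norm (x $ i))\<^sup>2))"
    by (simp add: star_prod_def)
  also have "\<dots> = of_real ((norm x)\<^sup>2)"
    by (simp add: norm_vec_def L2_set_def sum_nonneg)
  finally show ?thesis .
qed

definition star_center :: "'a::real_vector set \<Rightarrow> 'a set" where
  "star_center S =
     {s0 \<in> S. \<forall>s\<in>S. \<forall>\<alpha>\<in>{0..1}. (1 - \<alpha>) *\<^sub>R s0 + \<alpha> *\<^sub>R s \<in> S}"

definition left_deriv :: "(real \<Rightarrow> real) \<Rightarrow> real \<Rightarrow> ereal" where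
  "left_deriv f t = Lim (at_left t) (\<lambda>s. ereal ((f s - f t) / (s - t)))"

text \<open>
  The line \<open>x = c y + d\<close> in the complex plane.  In \<^typ>\<open>ereal\<close> the convention
  \<open>0 \<cdot> (\<plusminus>\<infinity>) = 0\<close> holds, so for infinite slope \<open>c\<close> only the point \<open>(d, 0)\<close> remains.
\<close>

definition cline :: "ereal \<Rightarrow> real \<Rightarrow> quat set" where
  "cline c d = {cpt x y | x y. ereal x = c * ereal y + ereal d}"

lemma cline_infinite_slope: "\<bar>c\<bar> = \<infinity> \<Longrightarrow> cline c d = {cpt d 0}"
proof -
  assume "\<bar>c\<bar> = \<infinity>"
  then have "ereal x = c * ereal y + ereal d \<longleftrightarrow> x = d \<and> y = 0" for x y
    by (cases c; cases "y = 0") auto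
  then show ?thesis by (auto simp: cline_def)
qed

end

theory Submission
  imports Defs
begin

text \<open>
  Write \<open>x\<^sup>* A x\<close> as a real part plus an imaginary part. Multiplying \<open>x\<close> on the right by a unit
  quaternion rotates the imaginary part arbitrarily, so \<open>W\<close> is the axially symmetric set
  obtained from the planar set \<open>D\<close> of all pairs (real part, length of imaginary part).
  Everything rests on the convexity of the compact set \<open>D\<close>, the theorem of So and Thompson
  (\<open>convex_upper_bild\<close>).

  For that theorem it is enough to look at the span of two vectors. Gram-Schmidt for the
  skew-Hermitian part of \<open>A\<close> gives two vectors \<open>z, w\<close> whose span contains the given ones and in
  which that part is diagonal (\<open>skew_diagonal_basis\<close>). The vector \<open>z p + w q\<close> is encoded by the
  positive semidefinite matrix with entries \<open>\<bar>p\<bar>\<^sup>2\<close>, \<open>\<bar>q\<bar>\<^sup>2\<close>, \<open>p q\<^sup>*\<close>, which has rank at most one. The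
  squared norm and the real part are linear in this matrix, and the length of the imaginary
  part has two extensions to the cone of all positive semidefinite matrices, a convex one and
  a concave one. Each extension is constant in a three-dimensional space of directions, so a
  convex combination of two rank-one matrices can be moved back to rank one with the two
  linear quantities and one of the extensions unchanged. The intermediate value theorem
  between the two extensions finishes the argument (\<open>gram_null_joint_convex\<close>).

  With \<open>D\<close> convex, the rest is plane geometry. A point \<open>(x, y)\<close> of \<open>B\<close> belongs to the star-center if
  and only if every segment from it to a point of \<open>B\<close> across the real axis crosses the axis
  inside \<open>W \<inter> \<real> = [m, M]\<close> (\<open>star_center_axial_iff\<close>). Letting the second point run along the
  boundary curves \<open>x\<^sub>1\<close> and \<open>x\<^sub>2\<close> turns this condition into a comparison with their difference
  quotients at \<open>0\<close>, whose supremum and infimum are \<open>a\<close> and \<open>b\<close> by convexity. Thus, for finite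
  slopes, the planar part of the star-center is cut out of \<open>B\<close> by \<open>m + a \<bar>y\<bar> \<le> x \<le> M + b \<bar>y\<bar>\<close>.
  Since \<open>b < 0 < a\<close>, these inequalities describe the kite with vertices \<open>m\<close>, \<open>M\<close> and the
  intersection point of the two lines with its conjugate (\<open>convex_hull_kite\<close>). If a slope is
  infinite, then \<open>m = M\<close>, and kite and star-center reduce to this point.
\<close>

section \<open>Quaternions and rotations of the imaginary space\<close>

lemma qcnj_sel [simp]:
  "qRe (qcnj q) = qRe q" "qI (qcnj q) = - qI q" "qJ (qcnj q) = - qJ q" "qK (qcnj q) = - qK q"
  by (simp_all add: qcnj_def)

lemma qcnj_add [simp]: "qcnj (p + q) = qcnj p + qcnj q"
  by (simp add: quat_eq_iff)

lemma qcnj_zero [simp]: "qcnj 0 = 0"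
  by (simp add: quat_eq_iff)

lemma qcnj_qcnj [simp]: "qcnj (qcnj q) = q"
  by (simp add: quat_eq_iff)

lemma qcnj_mult: "qcnj (p * q) = qcnj q * qcnj p"
  by (simp add: quat_eq_iff algebra_simps)

lemma qcnj_of_real [simp]: "qcnj (of_real r) = of_real r"
  by (simp add: quat_eq_iff)

lemma norm_quat_power2: "(norm q)\<^sup>2 = (qRe q)\<^sup>2 + (qI q)\<^sup>2 + (qJ q)\<^sup>2 + (qK q)\<^sup>2"
  by (simp add: norm_quat_def inner_quat_def power2_eq_square)

lemma norm_qcnj [simp]: "norm (qcnj q) = norm q"
  by (simp add: norm_quat_def inner_quat_def)

lemma qcnj_mult_self: "qcnj q * q = of_real ((norm q)\<^sup>2)"
  unfolding norm_quat_power2 by (simp add: quat_eq_iff power2_eq_square)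

lemma pure_quat_square: "qRe u = 0 \<Longrightarrow> u * u = - of_real ((norm u)\<^sup>2)"
  unfolding norm_quat_power2 by (simp add: quat_eq_iff power2_eq_square)

lemma mult_qcnj_self: "q * qcnj q = of_real ((norm q)\<^sup>2)"
  using qcnj_mult_self[of "qcnj q"] by simp

text \<open>
  Euler's four-square identity.
\<close>
lemma norm_quat_mult: "norm (p * q :: quat) = norm p * norm q"
proof -
  have "(norm (p * q))\<^sup>2 = (norm p * norm q)\<^sup>2"
    unfolding power_mult_distrib norm_quat_power2 quat_ring_sel by algebra
  then show ?thesis
    by (simp add: power2_eq_iff_nonneg)
qed

lemma norm_quat_of_real: "norm (of_real r :: quat) = \<bar>r\<bar>"
  by (simp add: norm_quat_def inner_quat_def)

lemma bounded_bilinear_quat_mult: "bounded_bilinear ((*) :: quat \<Rightarrow> quat \<Rightarrow> quat)"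
proof
  show "\<exists>K. \<forall>a b :: quat. norm (a * b) \<le> norm a * norm b * K"
    by (rule exI[of _ 1]) (simp add: norm_quat_mult)
qed (simp_all add: algebra_simps)

text \<open>
  The imaginary part is kept inside the quaternions, so that it carries their norm and
  product.
\<close>
definition qIm :: "quat \<Rightarrow> quat" where
  "qIm q = Quat 0 (qI q) (qJ q) (qK q)"

lemma qIm_sel [simp]: "qRe (qIm q) = 0" "qI (qIm q) = qI q" "qJ (qIm q) = qJ q" "qK (qIm q) = qK q"
  by (simp_all add: qIm_def)

lemma norm_qIm_cpt: "norm (qIm (cpt x y)) = \<bar>y\<bar>"
  by (simp add: cpt_eq_Quat qIm_def norm_quat_def inner_quat_def)

lemma qRe_cpt: "qRe (cpt x y) = x"
  by (simp add: cpt_eq_Quat)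

lemma qRe_add_qIm: "q = of_real (qRe q) + qIm q"
  by (simp add: quat_eq_iff)

text \<open>
  Unit quaternions act on the imaginary space by all rotations. The rotation taking \<open>u\<close> to
  \<open>v = \<bar>u\<bar> i\<close> is conjugation by \<open>u + v\<close>, because \<open>u (u + v) = (u + v) v\<close> whenever \<open>u\<close> and \<open>v\<close> are
  imaginary of the same length. This fails only for \<open>u = - v\<close>, where conjugation by \<open>j\<close> works.
\<close>
lemma rotate_to_qi:
  assumes "qRe u = 0"
  obtains q where "norm q = 1" "qcnj q * u * q = of_real (norm u) * qi"
proof -
  define v where "v = of_real (norm u) * qi"
  have nv: "norm v = norm u"
    by (simp add: v_def norm_quat_mult norm_quat_def inner_quat_def qi_def)
  have sq: "u * u = - of_real ((norm u)\<^sup>2)" "v * v = - of_real ((norm u)\<^sup>2)"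
    using pure_quat_square[OF assms] pure_quat_square[of v] by (simp_all add: nv) (simp add: v_def qi_def)
  show ?thesis
  proof (cases "u + v = 0")
    case True
    show ?thesis
    proof (rule that[of qj])
      have "u = - v" using True by (simp add: eq_neg_iff_add_eq_0)
      then show "qcnj qj * u * qj = of_real (norm u) * qi"
        by (simp add: v_def qi_def qj_def quat_eq_iff)
    qed (simp add: qj_def norm_quat_def inner_quat_def)
  next
    case False
    define k where "k = norm (u + v)"
    have k: "k > 0" using False by (simp add: k_def)
    define q where "q = (1 / k) *\<^sub>R (u + v)"
    have nq: "norm q = 1" using k by (simp add: q_def k_def)
    have "u * q = q * v"
      by (simp add: q_def algebra_simps sq)
    then have "qcnj q * u * q = (qcnj q * q) * v"
      by (simp add: mult.assoc)
    then show ?thesis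
      using that[of q] nq by (simp add: qcnj_mult_self v_def)
  qed
qed

section \<open>Sesquilinear forms and the numerical range\<close>

text \<open>
  Vectors form a right module over the quaternions. The ambient scalar multiplications act on
  the left, so the right action gets its own name.
\<close>
definition rscale :: "quat^'n \<Rightarrow> quat \<Rightarrow> quat^'n" where
  "rscale x q = (\<chi> i. x $ i * q)"

text \<open>
  Keeping the two arguments of \<open>x\<^sup>* A y\<close> apart makes the numerical range accessible to expansion
  along a basis; \<open>A = mat 1\<close> gives the Hermitian inner product itself.
\<close>
definition form :: "quat^'n^'n \<Rightarrow> quat^'n \<Rightarrow> quat^'n \<Rightarrow> quat" where
  "form A x y = star_prod x (A *v y)"

lemma form_add_left: "form A (x + y) z = form A x z + form A y z"
  by (simp add: form_def star_prod_def sum.distrib algebra_simps)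

lemma form_add_right: "form A x (y + z) = form A x y + form A x z"
  by (simp add: form_def star_prod_def sum.distrib matrix_vector_right_distrib algebra_simps)

lemma form_rscale_left: "form A (rscale x p) y = qcnj p * form A x y"
  by (simp add: form_def star_prod_def rscale_def qcnj_mult sum_distrib_left mult.assoc)

lemma form_rscale_right: "form A x (rscale y p) = form A x y * p"
  by (simp add: form_def star_prod_def rscale_def matrix_vector_mult_def sum_distrib_right
      sum_distrib_left mult.assoc)

lemma form_mat_1: "form (mat 1) x y = star_prod x y"
  by (simp add: form_def)

lemma rscale_add: "rscale x (p + q) = rscale x p + rscale x q"
  by (simp add: rscale_def vec_eq_iff algebra_simps)

lemma rscale_add_vec: "rscale (x + y) p = rscale x p + rscale y p"
  by (simp add: rscale_def vec_eq_iff algebra_simps)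

lemma rscale_rscale: "rscale (rscale x p) q = rscale x (p * q)"
  by (simp add: rscale_def vec_eq_iff mult.assoc)

lemma rscale_one [simp]: "rscale x 1 = x" "rscale x 0 = 0"
  by (simp_all add: rscale_def vec_eq_iff)

lemma numerical_range_eq:
  fixes A :: "quat^'n^'n"
  shows "numerical_range A = {form A x x | x. norm x = 1}"
proof -
  have "star_prod x x = 1 \<longleftrightarrow> norm x = 1" for x :: "quat^'n"
  proof -
    have "star_prod x x = 1 \<longleftrightarrow> (norm x)\<^sup>2 = 1"
      unfolding star_prod_self by (metis of_real_eq_1_iff)
    then show ?thesis by (simp add: power2_eq_1_iff)
     (metis norm_ge_zero neg_0_le_iff_le not_one_le_zero)
  qed
  then show ?thesis by (simp add: numerical_range_def form_def)
qed

lemma continuous_on_form: "continuous_on S (\<lambda>x. form A x x)"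
proof -
  have lin: "linear qcnj"
    by (rule linearI) (simp_all add: quat_eq_iff)
  have 1: "continuous_on S (\<lambda>x. qcnj (x $ i))" for i
    using linear_continuous_on_compose[OF _ lin, of S "\<lambda>x. x $ i"]
    by (simp add: continuous_on_component continuous_on_id)
  have 2: "continuous_on S (\<lambda>x. A $ i $ j * x $ j)" for i j
    by (intro bounded_bilinear.continuous_on[OF bounded_bilinear_quat_mult] continuous_intros)
  show ?thesis
    unfolding form_def star_prod_def matrix_vector_mult_def
    by (simp, intro continuous_intros bounded_bilinear.continuous_on[OF bounded_bilinear_quat_mult] 1 2)
qed

lemma compact_numerical_range: "compact (numerical_range A)"
proof -
  have "numerical_range A = (\<lambda>x. form A x x) ` sphere 0 1"
    by (auto simp: numerical_range_eq)
  then show ?thesis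
    by (metis compact_continuous_image continuous_on_form compact_sphere)
qed

lemma norm_rscale: "norm (rscale x q) = norm x * norm q"
proof -
  have "(\<Sum>i\<in>UNIV. (norm (x $ i * q))\<^sup>2) = (\<Sum>i\<in>UNIV. (norm (x $ i))\<^sup>2) * (norm q)\<^sup>2"
    by (simp add: norm_quat_mult power_mult_distrib sum_distrib_right)
  then show ?thesis
    by (simp add: norm_vec_def L2_set_def rscale_def real_sqrt_mult)
qed

text \<open>
  Rescaling \<open>x\<close> by a unit quaternion \<open>q\<close> conjugates \<open>x\<^sup>* A x\<close> by \<open>q\<close>; this is the source of the axial
  symmetry of the numerical range.
\<close>
lemma numerical_range_rotate:
  assumes "w \<in> numerical_range A" "norm q = 1"
  shows "qcnj q * w * q \<in> numerical_range A"
proof -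
  obtain x where x: "norm x = 1" "w = form A x x"
    using assms(1) by (auto simp: numerical_range_eq)
  have "norm (rscale x q) = 1" using x assms by (simp add: norm_rscale)
  moreover have "form A (rscale x q) (rscale x q) = qcnj q * w * q"
    by (simp add: form_rscale_left form_rscale_right x mult.assoc)
  ultimately show ?thesis by (force simp: numerical_range_eq)
qed

text \<open>
  Every quaternion is similar to the point of the closed upper half plane with the same real
  part and the same length of the imaginary part.
\<close>
lemma rotate_to_cpt:
  obtains q where "norm q = 1" "qcnj q * w * q = cpt (qRe w) (norm (qIm w))"
proof -
  obtain q where q: "norm q = 1" "qcnj q * qIm w * q = of_real (norm (qIm w)) * qi"
    using rotate_to_qi[of "qIm w"] by auto
  have comm: "of_real c * p = p * of_real c" for c and p :: quat
    by (simp add: quat_eq_iff)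
  have "qcnj q * w * q = qcnj q * of_real (qRe w) * q + qcnj q * qIm w * q"
    by (subst (1) qRe_add_qIm[of w]) (simp add: algebra_simps)
  also have "qcnj q * of_real (qRe w) * q = of_real (qRe w)"
    using q(1) by (metis comm mult.assoc mult.right_neutral qcnj_mult_self of_real_1 one_power2)
  finally show ?thesis
    using that q by (simp add: cpt_def comm)
qed

text \<open>
  By axial symmetry the numerical range is determined by its part in the upper half plane.
\<close>
lemma numerical_range_cpt_iff:
  "w \<in> numerical_range A \<longleftrightarrow> cpt (qRe w) (norm (qIm w)) \<in> numerical_range A"
proof -
  obtain q where q: "norm q = 1" "qcnj q * w * q = cpt (qRe w) (norm (qIm w))"
    by (rule rotate_to_cpt)
  have one: "q * qcnj q = 1"
    using q by (simp add: mult_qcnj_self)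
  have "w = qcnj (qcnj q) * cpt (qRe w) (norm (qIm w)) * qcnj q"
    unfolding q(2)[symmetric] by simp (metis mult.assoc mult.left_neutral mult.right_neutral one)
  then show ?thesis
    using numerical_range_rotate[of w A q] numerical_range_rotate[of _ A "qcnj q"] q by (metis norm_qcnj)
qed

section \<open>The cone of positive semidefinite Gram data\<close>

text \<open>
  For fixed vectors \<open>z\<close> and \<open>w\<close>, the combination \<open>z p + w q\<close> is recorded up to a common right unit
  factor by the entries \<open>P = \<bar>p\<bar>\<^sup>2\<close>, \<open>Q = \<bar>q\<bar>\<^sup>2\<close>, \<open>v = p q\<^sup>*\<close> of a Hermitian \<open>2 \<times> 2\<close> matrix.
\<close>
type_synonym gram = "real \<times> real \<times> quat"

text \<open>
  The positive semidefinite Hermitian \<open>2 \<times> 2\<close> quaternionic matrices: up to a linear change of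
  coordinates, a solid Lorentz cone in a real space of dimension six.
\<close>
definition gram_cone :: "gram set" where
  "gram_cone = {(P, Q, v). 0 \<le> P \<and> 0 \<le> Q \<and> (norm v)\<^sup>2 \<le> P * Q}"

text \<open>
  This is the superadditivity of the geometric mean together with the triangle inequality:
  \<open>\<bar>v + v'\<bar> \<le> \<surd>(P Q) + \<surd>(P' Q') \<le> \<surd>((P + P') (Q + Q'))\<close>.
\<close>
lemma convex_gram_cone: "convex gram_cone"
  unfolding convex_def
proof (intro ballI allI impI)
  fix x y :: gram and s t :: real
  assume xy: "x \<in> gram_cone" "y \<in> gram_cone" and st: "0 \<le> s" "0 \<le> t" "s + t = 1"
  obtain P Q v P' Q' v' where e: "x = (P, Q, v)" "y = (P', Q', v')"
    by (metis prod_cases3)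
  have c: "0 \<le> P" "0 \<le> Q" "(norm v)\<^sup>2 \<le> P * Q" "0 \<le> P'" "0 \<le> Q'" "(norm v')\<^sup>2 \<le> P' * Q'"
    using xy by (auto simp: e gram_cone_def)
  have vw: "2 * (norm v * norm v') \<le> P * Q' + P' * Q"
  proof (rule power2_le_imp_le)
    have "(norm v)\<^sup>2 * (norm v')\<^sup>2 \<le> (P * Q) * (P' * Q')"
      using c by (intro mult_mono) auto
    then have "(2 * (norm v * norm v'))\<^sup>2 \<le> 4 * ((P * Q') * (P' * Q))"
      by (simp add: power_mult_distrib algebra_simps)
    also have "\<dots> \<le> (P * Q' + P' * Q)\<^sup>2"
      using sum_squares_ge_zero[of "P * Q' - P' * Q" 0] by (simp add: power2_eq_square algebra_simps)
    finally show "(2 * (norm v * norm v'))\<^sup>2 \<le> (P * Q' + P' * Q)\<^sup>2" .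
  qed (use c in simp)
  have "norm (s *\<^sub>R v + t *\<^sub>R v') \<le> s * norm v + t * norm v'"
    using norm_triangle_ineq[of "s *\<^sub>R v" "t *\<^sub>R v'"] st by simp
  then have "(norm (s *\<^sub>R v + t *\<^sub>R v'))\<^sup>2 \<le> (s * norm v + t * norm v')\<^sup>2"
    by (simp add: power_mono)
  also have "\<dots> = s * s * (norm v)\<^sup>2 + t * t * (norm v')\<^sup>2 + s * t * (2 * (norm v * norm v'))"
    by (simp add: power2_eq_square algebra_simps)
  also have "\<dots> \<le> s * s * (P * Q) + t * t * (P' * Q') + s * t * (P * Q' + P' * Q)"
    using c st vw by (intro add_mono mult_left_mono) auto
  also have "\<dots> = (s * P + t * P') * (s * Q + t * Q')"
    by (simp add: algebra_simps)
  finally show "s *\<^sub>R x + t *\<^sub>R y \<in> gram_cone"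
    using c st by (simp add: e gram_cone_def)
qed

lemma closed_gram_cone: "closed gram_cone"
proof -
  have "gram_cone = {u. 0 \<le> fst u} \<inter> {u. 0 \<le> fst (snd u)} \<inter>
      {u. (norm (snd (snd u)))\<^sup>2 \<le> fst u * fst (snd u)}"
    by (auto simp: gram_cone_def)
  moreover have "closed \<dots>"
    by (intro closed_Int closed_Collect_le continuous_intros)
  ultimately show ?thesis by simp
qed

text \<open>
  The matrices of rank at most one, that is, those which come from an actual pair \<open>(p, q)\<close>.
\<close>
definition gram_null :: "gram set" where
  "gram_null = {(P, Q, v). 0 \<le> P \<and> 0 \<le> Q \<and> (norm v)\<^sup>2 = P * Q}"

lemma gram_null_subset: "gram_null \<subseteq> gram_cone"
  by (auto simp: gram_null_def gram_cone_def)

lemma frontier_gram_cone_subset: "frontier gram_cone \<subseteq> gram_null"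
proof
  fix u assume assms: "u \<in> frontier gram_cone"
  obtain P Q v where u: "u = (P, Q, v)" by (metis prod_cases3)
  note assms = assms[unfolded u]
  have mem: "(P, Q, v) \<in> gram_cone"
    using assms closed_gram_cone frontier_subset_closed by blast
  then have "0 \<le> P" "0 \<le> Q" by (auto simp: gram_cone_def)
  let ?U = "{u :: gram. 0 < fst u} \<inter> {u. 0 < fst (snd u)} \<inter>
      {u. (norm (snd (snd u)))\<^sup>2 < fst u * fst (snd u)}"
  have "open ?U"
    by (intro open_Int open_Collect_less continuous_intros)
  moreover have "?U \<subseteq> gram_cone" by (auto simp: gram_cone_def)
  ultimately have "?U \<subseteq> interior gram_cone" by (simp add: interior_maximal)
  moreover have "(P, Q, v) \<notin> interior gram_cone"
    using assms by (simp add: frontier_def)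
  ultimately have "(P, Q, v) \<notin> ?U" by blast
  moreover have "0 < P \<and> 0 < Q" if "(norm v)\<^sup>2 < P * Q"
  proof -
    have "0 < P * Q" using that by (meson le_less_trans zero_le_power2)
    then show ?thesis using \<open>0 \<le> P\<close> \<open>0 \<le> Q\<close> by (metis less_eq_real_def mult_zero_left mult_zero_right)
  qed
  ultimately show "u \<in> gram_null"
    using mem by (auto simp: u gram_cone_def gram_null_def)
qed

lemma affine_bounded_below_imp_const:
  fixes p d :: real
  assumes "\<And>\<tau>. 0 \<le> p + \<tau> * d"
  shows "d = 0"
proof (rule ccontr)
  assume "d \<noteq> 0"
  then show False using assms[of "- (p + 1) / d"] by simp
qed

text \<open>
  The cone contains no line, so every line through one of its points leaves it and therefore
  meets its boundary.
\<close>
lemma gram_cone_exit: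
  assumes u: "u \<in> gram_cone" and d: "d \<noteq> 0"
  obtains \<tau> where "u + \<tau> *\<^sub>R d \<in> gram_null"
proof -
  let ?L = "range (\<lambda>\<tau>. u + \<tau> *\<^sub>R d)"
  obtain P Q v where ue: "u = (P, Q, v)" by (metis prod_cases3)
  obtain P' Q' v' where de: "d = (P', Q', v')" by (metis prod_cases3)
  have "\<not> ?L \<subseteq> gram_cone"
  proof
    assume "?L \<subseteq> gram_cone"
    then have "u + \<tau> *\<^sub>R d \<in> gram_cone" for \<tau> by blast
    then have all: "0 \<le> P + \<tau> * P'" "0 \<le> Q + \<tau> * Q'"
      "(norm (v + \<tau> *\<^sub>R v'))\<^sup>2 \<le> (P + \<tau> * P') * (Q + \<tau> * Q')" for \<tau>
      by (auto simp: ue de gram_cone_def)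
    have z: "P' = 0" "Q' = 0"
      using affine_bounded_below_imp_const all(1,2) by blast+
    have "v' \<noteq> 0" using d z by (auto simp: de zero_prod_def)
    define c where "c = sqrt (P * Q)"
    have b: "norm (v + \<tau> *\<^sub>R v') \<le> c" for \<tau>
      using all(3)[of \<tau>] by (simp add: z c_def real_le_rsqrt)
    \<comment> \<open>At this parameter the moving part alone has norm \<open>|v| + c + 1\<close>, too long for the bound \<open>c\<close>.\<close>
    define \<tau> where "\<tau> = (norm v + c + 1) / norm v'"
    have "c \<ge> 0" using b[of 0] norm_ge_zero order_trans by blast
    then have "norm (\<tau> *\<^sub>R v') = norm v + c + 1"
      using \<open>v' \<noteq> 0\<close> by (simp add: \<tau>_def)
    moreover have "norm (\<tau> *\<^sub>R v') \<le> norm (v + \<tau> *\<^sub>R v') + norm v"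
      using norm_triangle_ineq4[of "v + \<tau> *\<^sub>R v'" v] by simp
    ultimately show False using b[of \<tau>] by simp
  qed
  moreover have "connected ?L"
    by (intro connected_continuous_image continuous_intros) simp
  moreover have "u \<in> ?L" by (rule range_eqI[of _ _ 0]) simp
  ultimately have "?L \<inter> frontier gram_cone \<noteq> {}"
    using u by (intro connected_Int_frontier) auto
  then show ?thesis using that frontier_gram_cone_subset by blast
qed

lemma common_kernel_direction:
  fixes f g :: "'a::euclidean_space \<Rightarrow> real"
  assumes "linear f" "linear g" "DIM('a) > 2"
  obtains d where "d \<noteq> 0" "f d = 0" "g d = 0"
proof -
  let ?h = "\<lambda>x. (f x, g x)"
  have lin: "linear ?h"
    using assms by (auto intro!: linearI simp: linear_add linear_scale)
  have "\<not> inj ?h"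
  proof
    assume "inj ?h"
    then have "dim (range ?h) = DIM('a)"
      using dim_image_eq[OF lin, of UNIV] by simp
    then have "DIM('a) \<le> DIM(real \<times> real)"
      using dim_subset_UNIV[of "range ?h"] by simp
    then show False using assms(3) by simp
  qed
  then obtain d where "d \<noteq> 0" "?h d = 0"
    using linear_injective_0[OF lin] by auto
  then show ?thesis using that by (simp add: zero_prod_def)
qed

section \<open>A convex and a concave extension of the imaginary length\<close>

text \<open>
  Suppose \<open>z\<^sup>* S w = 0\<close>, \<open>z\<^sup>* S z = \<alpha> i\<close> and \<open>w\<^sup>* S w = \<beta> i\<close> for a skew-Hermitian \<open>S\<close> and reals \<open>\<alpha>, \<beta> \<ge> 0\<close>.
  Then \<open>S\<close> takes the value \<open>\<alpha> p\<^sup>* i p + \<beta> q\<^sup>* i q\<close> at \<open>z p + w q\<close>. With \<open>v = v\<^sub>0 + v\<^sub>1 i + v\<^sub>2 j + v\<^sub>3 k\<close>,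
  the squared length of this value is \<open>\<alpha>\<^sup>2 P\<^sup>2 + \<beta>\<^sup>2 Q\<^sup>2 + 2 \<alpha> \<beta> (v\<^sub>0\<^sup>2 + v\<^sub>1\<^sup>2 - v\<^sub>2\<^sup>2 - v\<^sub>3\<^sup>2)\<close>. The
  relation \<open>P Q = \<bar>v\<bar>\<^sup>2\<close> lets this be rewritten in two ways: as \<open>(\<alpha> P - \<beta> Q)\<^sup>2 + 4 \<alpha> \<beta> (v\<^sub>0\<^sup>2 + v\<^sub>1\<^sup>2)\<close>,
  whose square root is a seminorm, and as \<open>(\<alpha> P + \<beta> Q)\<^sup>2 - 4 \<alpha> \<beta> (v\<^sub>2\<^sup>2 + v\<^sub>3\<^sup>2)\<close>, whose square root
  is concave on the cone. These two extensions from the rank-one matrices to the whole cone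
  are the lower and the upper norm.
\<close>
fun lower_map :: "real \<Rightarrow> real \<Rightarrow> gram \<Rightarrow> real \<times> real \<times> real" where
  "lower_map \<alpha> \<beta> (P, Q, v) =
     (\<alpha> * P - \<beta> * Q, 2 * sqrt (\<alpha> * \<beta>) * qRe v, 2 * sqrt (\<alpha> * \<beta>) * qI v)"

fun upper_map :: "real \<Rightarrow> real \<Rightarrow> gram \<Rightarrow> real \<times> real" where
  "upper_map \<alpha> \<beta> (P, Q, v) = (2 * sqrt (\<alpha> * \<beta>) * qJ v, 2 * sqrt (\<alpha> * \<beta>) * qK v)"

fun weight :: "real \<Rightarrow> real \<Rightarrow> gram \<Rightarrow> real" where
  "weight \<alpha> \<beta> (P, Q, v) = \<alpha> * P + \<beta> * Q"

definition lower_norm :: "real \<Rightarrow> real \<Rightarrow> gram \<Rightarrow> real" where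
  "lower_norm \<alpha> \<beta> u = norm (lower_map \<alpha> \<beta> u)"

definition upper_norm :: "real \<Rightarrow> real \<Rightarrow> gram \<Rightarrow> real" where
  "upper_norm \<alpha> \<beta> u = sqrt ((weight \<alpha> \<beta> u)\<^sup>2 - (norm (upper_map \<alpha> \<beta> u))\<^sup>2)"

lemma linear_maps:
  "linear (lower_map \<alpha> \<beta>)" "linear (upper_map \<alpha> \<beta>)" "linear (weight \<alpha> \<beta>)"
  by (rule linearI; auto simp: algebra_simps)+

lemmas linear_maps_simps =
  linear_maps[THEN linear_add] linear_maps[THEN linear_scale]

lemma lower_norm_power2:
  assumes "0 \<le> \<alpha>" "0 \<le> \<beta>"
  shows "(lower_norm \<alpha> \<beta> (P, Q, v))\<^sup>2 = (\<alpha> * P - \<beta> * Q)\<^sup>2 + 4 * \<alpha> * \<beta> * ((qRe v)\<^sup>2 + (qI v)\<^sup>2)"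
  using assms by (simp add: lower_norm_def norm_Pair power_mult_distrib algebra_simps)

lemma norm_upper_map_power2:
  assumes "0 \<le> \<alpha>" "0 \<le> \<beta>"
  shows "(norm (upper_map \<alpha> \<beta> (P, Q, v)))\<^sup>2 = 4 * \<alpha> * \<beta> * ((qJ v)\<^sup>2 + (qK v)\<^sup>2)"
  using assms by (simp add: norm_Pair power_mult_distrib algebra_simps)

lemma lower_norm_eq_upper_norm:
  assumes "0 \<le> \<alpha>" "0 \<le> \<beta>" "u \<in> gram_null"
  shows "lower_norm \<alpha> \<beta> u = upper_norm \<alpha> \<beta> u"
proof -
  obtain P Q v where u: "u = (P, Q, v)" by (metis prod_cases3)
  have *: "(qRe v)\<^sup>2 + (qI v)\<^sup>2 + (qJ v)\<^sup>2 + (qK v)\<^sup>2 = P * Q"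
    using assms(3) by (simp add: u gram_null_def norm_quat_power2)
  have "(\<alpha> * P - \<beta> * Q)\<^sup>2 + 4 * \<alpha> * \<beta> * ((qRe v)\<^sup>2 + (qI v)\<^sup>2)
      = (\<alpha> * P + \<beta> * Q)\<^sup>2 - 4 * \<alpha> * \<beta> * ((qJ v)\<^sup>2 + (qK v)\<^sup>2)"
    using * by algebra
  then have "(lower_norm \<alpha> \<beta> u)\<^sup>2 = (weight \<alpha> \<beta> u)\<^sup>2 - (norm (upper_map \<alpha> \<beta> u))\<^sup>2"
    unfolding u using assms by (simp add: lower_norm_power2 norm_upper_map_power2 del: upper_map.simps)
  then show ?thesis
    by (simp add: upper_norm_def) (metis lower_norm_def norm_ge_zero real_sqrt_unique)
qed

text \<open>
  The reversed triangle inequality in Minkowski space.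
\<close>
lemma reverse_minkowski:
  fixes b d :: "'a::real_inner"
  assumes "norm b \<le> A" "norm d \<le> C"
  shows "sqrt (A\<^sup>2 - (norm b)\<^sup>2) + sqrt (C\<^sup>2 - (norm d)\<^sup>2) \<le> sqrt ((A + C)\<^sup>2 - (norm (b + d))\<^sup>2)"
proof (rule real_le_rsqrt)
  let ?X = "A\<^sup>2 - (norm b)\<^sup>2" and ?Y = "C\<^sup>2 - (norm d)\<^sup>2"
  have pos: "0 \<le> A" "0 \<le> C" using assms norm_ge_zero order_trans by blast+
  have XY: "0 \<le> ?X" "0 \<le> ?Y" using assms by (simp_all add: power_mono)
  have "sqrt ?X * sqrt ?Y \<le> A * C - norm b * norm d"
  proof (rule power2_le_imp_le)
    have "(A * C - norm b * norm d)\<^sup>2 - ?X * ?Y = (A * norm d - C * norm b)\<^sup>2"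
      by (simp add: power2_eq_square algebra_simps)
    then have "?X * ?Y \<le> (A * C - norm b * norm d)\<^sup>2"
      by (metis diff_ge_0_iff_ge zero_le_power2)
    then show "(sqrt ?X * sqrt ?Y)\<^sup>2 \<le> (A * C - norm b * norm d)\<^sup>2"
      using XY by (simp add: power_mult_distrib)
    show "0 \<le> A * C - norm b * norm d"
      using mult_mono[OF assms] pos by simp
  qed
  moreover have "inner b d \<le> norm b * norm d" by (rule norm_cauchy_schwarz)
  moreover have "(norm (b + d))\<^sup>2 = (norm b)\<^sup>2 + (norm d)\<^sup>2 + 2 * inner b d"
    by (simp add: power2_norm_eq_inner inner_add inner_commute)
  ultimately show "(sqrt ?X + sqrt ?Y)\<^sup>2 \<le> (A + C)\<^sup>2 - (norm (b + d))\<^sup>2"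
    using XY by (simp add: power2_sum)
qed

text \<open>
  The inequality of the arithmetic and geometric means: \<open>4 \<alpha> \<beta> \<bar>v\<bar>\<^sup>2 \<le> 4 \<alpha> \<beta> P Q \<le> (\<alpha> P + \<beta> Q)\<^sup>2\<close>.
\<close>
lemma norm_upper_map_le_weight:
  assumes "0 \<le> \<alpha>" "0 \<le> \<beta>" "u \<in> gram_cone"
  shows "norm (upper_map \<alpha> \<beta> u) \<le> weight \<alpha> \<beta> u"
proof -
  obtain P Q v where u: "u = (P, Q, v)" by (metis prod_cases3)
  have c: "0 \<le> P" "0 \<le> Q" "(qRe v)\<^sup>2 + (qI v)\<^sup>2 + (qJ v)\<^sup>2 + (qK v)\<^sup>2 \<le> P * Q"
    using assms by (auto simp: u gram_cone_def norm_quat_power2)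
  have "4 * \<alpha> * \<beta> * ((qJ v)\<^sup>2 + (qK v)\<^sup>2) \<le> 4 * \<alpha> * \<beta> * (P * Q)"
  proof (rule mult_left_mono)
    show "(qJ v)\<^sup>2 + (qK v)\<^sup>2 \<le> P * Q"
      using c(3) zero_le_power2[of "qRe v"] zero_le_power2[of "qI v"] by linarith
  qed (use assms in simp)
  also have "\<dots> \<le> (\<alpha> * P + \<beta> * Q)\<^sup>2"
    using zero_le_power2[of "\<alpha> * P - \<beta> * Q"] by (simp add: power2_eq_square algebra_simps)
  finally have "(norm (upper_map \<alpha> \<beta> u))\<^sup>2 \<le> (weight \<alpha> \<beta> u)\<^sup>2"
    unfolding u norm_upper_map_power2[OF assms(1,2)] by simp
  then show ?thesis
    by (rule power2_le_imp_le) (use assms c in \<open>simp add: u\<close>)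
qed

lemma upper_norm_concave:
  assumes "0 \<le> \<alpha>" "0 \<le> \<beta>" "u \<in> gram_cone" "u' \<in> gram_cone" "0 \<le> s" "0 \<le> t"
  shows "s * upper_norm \<alpha> \<beta> u + t * upper_norm \<alpha> \<beta> u' \<le> upper_norm \<alpha> \<beta> (s *\<^sub>R u + t *\<^sub>R u')"
proof -
  have hom: "c * upper_norm \<alpha> \<beta> w
      = sqrt ((c * weight \<alpha> \<beta> w)\<^sup>2 - (norm (c *\<^sub>R upper_map \<alpha> \<beta> w))\<^sup>2)" if "0 \<le> c" for c w
  proof -
    have "(c * weight \<alpha> \<beta> w)\<^sup>2 - (norm (c *\<^sub>R upper_map \<alpha> \<beta> w))\<^sup>2
        = c\<^sup>2 * ((weight \<alpha> \<beta> w)\<^sup>2 - (norm (upper_map \<alpha> \<beta> w))\<^sup>2)"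
      by (simp add: power_mult_distrib algebra_simps)
    then show ?thesis using that by (simp add: upper_norm_def real_sqrt_mult)
  qed
  have "norm (c *\<^sub>R upper_map \<alpha> \<beta> w) \<le> c * weight \<alpha> \<beta> w" if "0 \<le> c" "w \<in> gram_cone" for c w
    using norm_upper_map_le_weight[OF assms(1,2) that(2)] that(1) by (simp add: mult_left_mono)
  then show ?thesis
    unfolding hom[OF assms(5)] hom[OF assms(6)]
    using assms reverse_minkowski[of "s *\<^sub>R upper_map \<alpha> \<beta> u" "s * weight \<alpha> \<beta> u"
        "t *\<^sub>R upper_map \<alpha> \<beta> u'" "t * weight \<alpha> \<beta> u'"]
    by (simp add: upper_norm_def linear_maps_simps)
qed

text \<open>
  A three-dimensional family of directions contains one on which two given functionals vanish;
  moving along it reaches a rank-one matrix without changing the two functionals.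
\<close>
lemma push_to_gram_null:
  fixes f g :: "gram \<Rightarrow> real" and D :: "real \<times> real \<times> real \<Rightarrow> gram"
  assumes u: "u \<in> gram_cone" and lin: "linear f" "linear g" "linear D" and inj: "inj D"
  obtains u' \<tau> d where "u' \<in> gram_null" "u' = u + \<tau> *\<^sub>R D d" "f u' = f u" "g u' = g u"
proof -
  have "linear (f \<circ> D)" "linear (g \<circ> D)"
    using lin by (auto intro: linear_compose)
  then obtain d where d: "d \<noteq> 0" "f (D d) = 0" "g (D d) = 0"
    using common_kernel_direction[of "f \<circ> D" "g \<circ> D"] by auto
  have "D d \<noteq> 0"
    using d(1) inj lin(3) linear_injective_0 by blast
  then obtain \<tau> where "u + \<tau> *\<^sub>R D d \<in> gram_null"
    using gram_cone_exit[OF u] by blast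
  then show ?thesis
    using that[of "u + \<tau> *\<^sub>R D d"] d by (simp add: lin[THEN linear_add] lin[THEN linear_scale])
qed

text \<open>
  In the plane of \<open>(P, Q)\<close> the vector \<open>(\<beta>', \<alpha>')\<close> is a direction in which \<open>\<alpha> P - \<beta> Q\<close> is constant,
  and \<open>(\<beta>', - \<alpha>')\<close> is one for \<open>\<alpha> P + \<beta> Q\<close>. It has to be nonzero even if \<open>\<alpha> = \<beta> = 0\<close>.
\<close>
lemma level_weights:
  fixes \<alpha> \<beta> :: real
  assumes "0 \<le> \<alpha>" "0 \<le> \<beta>"
  obtains \<alpha>' \<beta>' where "0 \<le> \<alpha>'" "0 \<le> \<beta>'" "(\<alpha>', \<beta>') \<noteq> (0, 0)" "\<alpha> * \<beta>' = \<beta> * \<alpha>'"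
proof (cases "\<alpha> = 0 \<and> \<beta> = 0")
  case True
  then show ?thesis using that[of 1 1] by simp
next
  case False
  then show ?thesis using that[of \<alpha> \<beta>] assms by auto
qed

text \<open>
  The lower norm ignores \<open>v\<^sub>2\<close>, \<open>v\<^sub>3\<close> and one direction in the plane of \<open>(P, Q)\<close>: three free
  dimensions, one more than the two functionals to be preserved.
\<close>
lemma push_lower:
  fixes f g :: "gram \<Rightarrow> real"
  assumes nn: "0 \<le> \<alpha>" "0 \<le> \<beta>" and u: "u \<in> gram_cone" and lin: "linear f" "linear g"
  obtains u' where "u' \<in> gram_null" "f u' = f u" "g u' = g u"
    "lower_norm \<alpha> \<beta> u' = lower_norm \<alpha> \<beta> u"
proof -
  obtain \<alpha>' \<beta>' where w: "(\<alpha>', \<beta>') \<noteq> (0, 0)" "\<alpha> * \<beta>' = \<beta> * \<alpha>'"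
    using level_weights[OF nn] by blast
  define D :: "real \<times> real \<times> real \<Rightarrow> gram" where "D = (\<lambda>(\<delta>, e, e'). (\<beta>' * \<delta>, \<alpha>' * \<delta>, Quat 0 0 e e'))"
  have "linear D"
    by (rule linearI) (auto simp: D_def quat_eq_iff algebra_simps)
  moreover have "inj D"
    using w by (auto simp: D_def inj_on_def)
  ultimately obtain u' \<tau> d where u': "u' \<in> gram_null" "u' = u + \<tau> *\<^sub>R D d" "f u' = f u" "g u' = g u"
    using push_to_gram_null[OF u lin] by blast
  have "\<alpha> * (\<beta>' * \<delta>) = \<beta> * (\<alpha>' * \<delta>)" for \<delta>
    by (metis mult.assoc w(2))
  then have "lower_map \<alpha> \<beta> (D d) = 0"
    by (simp add: D_def zero_prod_def split: prod.split)
  then have "lower_norm \<alpha> \<beta> u' = lower_norm \<alpha> \<beta> u"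
    unfolding lower_norm_def u'(2) by (simp add: linear_maps_simps)
  with u' that show ?thesis by blast
qed

text \<open>
  For the upper norm the free dimensions are \<open>v\<^sub>0\<close>, \<open>v\<^sub>1\<close> and one direction in the plane of \<open>(P, Q)\<close>.
\<close>
lemma push_upper:
  fixes f g :: "gram \<Rightarrow> real"
  assumes nn: "0 \<le> \<alpha>" "0 \<le> \<beta>" and u: "u \<in> gram_cone" and lin: "linear f" "linear g"
  obtains u' where "u' \<in> gram_null" "f u' = f u" "g u' = g u"
    "upper_norm \<alpha> \<beta> u' = upper_norm \<alpha> \<beta> u"
proof -
  obtain \<alpha>' \<beta>' where w: "(\<alpha>', \<beta>') \<noteq> (0, 0)" "\<alpha> * \<beta>' = \<beta> * \<alpha>'"
    using level_weights[OF nn] by blast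
  define D :: "real \<times> real \<times> real \<Rightarrow> gram" where "D = (\<lambda>(\<delta>, e, e'). (\<beta>' * \<delta>, - \<alpha>' * \<delta>, Quat e e' 0 0))"
  have "linear D"
    by (rule linearI) (auto simp: D_def quat_eq_iff algebra_simps)
  moreover have "inj D"
    using w by (auto simp: D_def inj_on_def)
  ultimately obtain u' \<tau> d where u': "u' \<in> gram_null" "u' = u + \<tau> *\<^sub>R D d" "f u' = f u" "g u' = g u"
    using push_to_gram_null[OF u lin] by blast
  have "\<alpha> * (\<beta>' * \<delta>) = \<beta> * (\<alpha>' * \<delta>)" for \<delta>
    by (metis mult.assoc w(2))
  then have "upper_map \<alpha> \<beta> (D d) = 0" "weight \<alpha> \<beta> (D d) = 0"
    by (simp_all add: D_def zero_prod_def split: prod.split)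
  then have "upper_norm \<alpha> \<beta> u' = upper_norm \<alpha> \<beta> u"
    unfolding upper_norm_def u'(2) by (simp add: linear_maps_simps)
  with u' that show ?thesis by blast
qed

text \<open>
  The heart of the convexity theorem. At a convex combination \<open>u\<^sub>0\<close> of two rank-one matrices the
  lower norm is at most the target value, by convexity, and the upper norm is at least the
  target value, by concavity. Pushing \<open>u\<^sub>0\<close> to rank one along the upper norm yields a matrix at
  which the two norms agree, hence one whose lower norm is large enough. On the segment in
  between, the lower norm attains the target, and a push along the lower norm brings that
  point to rank one.
\<close>
lemma gram_null_joint_convex:
  fixes f g :: "gram \<Rightarrow> real"
  assumes "0 \<le> \<alpha>" "0 \<le> \<beta>" and lin: "linear f" "linear g"
    and u: "u1 \<in> gram_null" "u2 \<in> gram_null"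
    and st: "0 \<le> s" "0 \<le> t" "s + t = 1"
  obtains u where "u \<in> gram_null" "f u = s * f u1 + t * f u2" "g u = s * g u1 + t * g u2"
    "lower_norm \<alpha> \<beta> u = s * lower_norm \<alpha> \<beta> u1 + t * lower_norm \<alpha> \<beta> u2"
proof -
  define r where "r = s * lower_norm \<alpha> \<beta> u1 + t * lower_norm \<alpha> \<beta> u2"
  define u0 where "u0 = s *\<^sub>R u1 + t *\<^sub>R u2"
  have C: "u1 \<in> gram_cone" "u2 \<in> gram_cone"
    using u gram_null_subset by blast+
  then have C0: "u0 \<in> gram_cone"
    using convex_gram_cone st unfolding u0_def convex_def by blast
  have fg: "f u0 = s * f u1 + t * f u2" "g u0 = s * g u1 + t * g u2"
    by (simp_all add: u0_def lin[THEN linear_add] lin[THEN linear_scale])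
  have low: "lower_norm \<alpha> \<beta> u0 \<le> r"
    using norm_triangle_ineq[of "s *\<^sub>R lower_map \<alpha> \<beta> u1" "t *\<^sub>R lower_map \<alpha> \<beta> u2"] st
    by (simp add: u0_def r_def lower_norm_def linear_maps_simps)
  have up: "r \<le> upper_norm \<alpha> \<beta> u0"
    using upper_norm_concave[OF assms(1,2) C st(1,2)] u
    by (simp add: u0_def r_def lower_norm_eq_upper_norm assms(1,2))
  obtain u3 where u3: "u3 \<in> gram_null" "f u3 = f u0" "g u3 = g u0"
    "upper_norm \<alpha> \<beta> u3 = upper_norm \<alpha> \<beta> u0"
    using push_upper[OF assms(1,2) C0 lin] by blast
  have C3: "u3 \<in> gram_cone"
    using u3 gram_null_subset by blast
  have "r \<le> lower_norm \<alpha> \<beta> u3"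
    using up u3 by (simp add: lower_norm_eq_upper_norm assms(1,2))
  define \<gamma> where "\<gamma> = (\<lambda>\<tau>. (1 - \<tau>) *\<^sub>R u0 + \<tau> *\<^sub>R u3)"
  have "continuous_on {0..1} (\<lambda>\<tau>. lower_norm \<alpha> \<beta> (\<gamma> \<tau>))"
    unfolding lower_norm_def \<gamma>_def
    by (intro continuous_intros linear_continuous_on_compose[OF _ linear_maps(1)])
  then obtain \<tau> where \<tau>: "0 \<le> \<tau>" "\<tau> \<le> 1" "lower_norm \<alpha> \<beta> (\<gamma> \<tau>) = r"
    using IVT'[of "\<lambda>\<tau>. lower_norm \<alpha> \<beta> (\<gamma> \<tau>)" 0 r 1] low \<open>r \<le> lower_norm \<alpha> \<beta> u3\<close>
    by (auto simp: \<gamma>_def)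
  have C\<tau>: "\<gamma> \<tau> \<in> gram_cone"
    using convex_gram_cone C0 C3 \<tau> unfolding \<gamma>_def convex_alt by blast
  have fg\<tau>: "f (\<gamma> \<tau>) = f u0" "g (\<gamma> \<tau>) = g u0"
    unfolding \<gamma>_def lin[THEN linear_add] lin[THEN linear_scale] u3 by (simp_all add: algebra_simps)
  obtain u' where "u' \<in> gram_null" "f u' = f (\<gamma> \<tau>)" "g u' = g (\<gamma> \<tau>)"
    "lower_norm \<alpha> \<beta> u' = lower_norm \<alpha> \<beta> (\<gamma> \<tau>)"
    using push_lower[OF assms(1,2) C\<tau> lin] by blast
  then show ?thesis
    using that[of u'] fg fg\<tau> \<tau> by (simp add: r_def)
qed

section \<open>Convexity of the upper half of the numerical range\<close>

definition gram_of :: "quat \<Rightarrow> quat \<Rightarrow> gram" where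
  "gram_of p q = ((norm p)\<^sup>2, (norm q)\<^sup>2, p * qcnj q)"

lemma gram_null_iff: "u \<in> gram_null \<longleftrightarrow> (\<exists>p q. u = gram_of p q)"
proof
  assume "u \<in> gram_null"
  then obtain P Q v where u: "u = (P, Q, v)" "0 \<le> P" "0 \<le> Q" "(norm v)\<^sup>2 = P * Q"
    by (auto simp: gram_null_def)
  show "\<exists>p q. u = gram_of p q"
  proof (cases "Q = 0")
    case True
    then have "u = gram_of (of_real (sqrt P)) 0"
      using u by (simp add: gram_of_def norm_quat_of_real)
    then show ?thesis by blast
  next
    case False
    have "u = gram_of ((1 / sqrt Q) *\<^sub>R v) (of_real (sqrt Q))"
      using u False by (simp add: gram_of_def power_mult_distrib power_divide norm_quat_of_real quat_eq_iff)
    then show ?thesis by blast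
  qed
qed (auto simp: gram_of_def gram_null_def norm_quat_mult power_mult_distrib)

definition gram_functional :: "real \<Rightarrow> real \<Rightarrow> quat \<Rightarrow> gram \<Rightarrow> real" where
  "gram_functional a b c = (\<lambda>(P, Q, v). a * P + b * Q + inner c v)"

lemma linear_gram_functional: "linear (gram_functional a b c)"
  by (rule linearI) (auto simp: gram_functional_def algebra_simps inner_add_right)

lemma form_pencil:
  "form A (rscale z p + rscale w q) (rscale z p + rscale w q) =
     qcnj p * form A z z * p + qcnj q * form A w w * q
       + (qcnj p * form A z w * q + qcnj q * form A w z * p)"
  by (simp add: form_add_left form_add_right form_rscale_left form_rscale_right algebra_simps)

lemma qRe_conjugate: "qRe (qcnj p * c * p) = qRe c * (norm p)\<^sup>2"
  unfolding norm_quat_power2 by (simp add: power2_eq_square algebra_simps)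

lemma qRe_form_pencil:
  "qRe (form A (rscale z p + rscale w q) (rscale z p + rscale w q)) =
     gram_functional (qRe (form A z z)) (qRe (form A w w)) (form A z w + qcnj (form A w z)) (gram_of p q)"
proof -
  have "qRe (qcnj p * c * q) + qRe (qcnj q * d * p) = inner (c + qcnj d) (p * qcnj q)" for c d
    by (simp add: inner_quat_def algebra_simps)
  then show ?thesis
    by (simp only: form_pencil gram_functional_def gram_of_def quat_ring_sel(9) qRe_conjugate case_prod_conv)
qed

lemma norm_qIm_form_pencil:
  assumes "form A z w = qcnj (form A w z)" "form A z z = cpt a \<alpha>" "form A w w = cpt b \<beta>"
    and "0 \<le> \<alpha>" "0 \<le> \<beta>"
  shows "norm (qIm (form A (rscale z p + rscale w q) (rscale z p + rscale w q)))
    = lower_norm \<alpha> \<beta> (gram_of p q)"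
proof -
  let ?X = "form A (rscale z p + rscale w q) (rscale z p + rscale w q)"
  have X: "?X = qcnj p * cpt a \<alpha> * p + qcnj q * cpt b \<beta> * q
       + (qcnj p * form A z w * q + qcnj (qcnj p * form A z w * q))"
    unfolding form_pencil assms by (simp add: qcnj_mult mult.assoc)
  have "qIm ?X = qIm (qcnj p * cpt 0 \<alpha> * p + qcnj q * cpt 0 \<beta> * q)"
    unfolding X by (simp add: quat_eq_iff cpt_eq_Quat algebra_simps)
  then have "(norm (qIm ?X))\<^sup>2 = (norm (qIm (qcnj p * cpt 0 \<alpha> * p + qcnj q * cpt 0 \<beta> * q)))\<^sup>2"
    by simp
  also have "\<dots> = (lower_norm \<alpha> \<beta> (gram_of p q))\<^sup>2"
    unfolding gram_of_def lower_norm_power2[OF assms(4,5)] norm_quat_power2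
    by (simp add: cpt_eq_Quat) algebra
  finally show ?thesis
    by (simp add: power2_eq_iff_nonneg lower_norm_def)
qed

definition rspan2 :: "quat^'n \<Rightarrow> quat^'n \<Rightarrow> (quat^'n) set" where
  "rspan2 z w = {rscale z p + rscale w q | p q. True}"

lemma rspan2_add: "x \<in> rspan2 z w \<Longrightarrow> y \<in> rspan2 z w \<Longrightarrow> x + y \<in> rspan2 z w"
proof -
  have "rscale z p + rscale w q + (rscale z p' + rscale w q') = rscale z (p + p') + rscale w (q + q')"
    for p q p' q' by (simp add: rscale_add)
  then show "x \<in> rspan2 z w \<Longrightarrow> y \<in> rspan2 z w \<Longrightarrow> ?thesis"
    unfolding rspan2_def by blast
qed

lemma rspan2_rscale: "x \<in> rspan2 z w \<Longrightarrow> rscale x c \<in> rspan2 z w"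
  unfolding rspan2_def by (force simp: rscale_add_vec rscale_rscale)

lemma rspan2_base: "z \<in> rspan2 z w" "w \<in> rspan2 z w"
proof -
  have "z = rscale z 1 + rscale w 0" "w = rscale z 0 + rscale w 1" by simp_all
  then show "z \<in> rspan2 z w" "w \<in> rspan2 z w" unfolding rspan2_def by blast+
qed

definition skew_form :: "quat^'n^'n \<Rightarrow> quat^'n \<Rightarrow> quat^'n \<Rightarrow> quat" where
  "skew_form A x y = form A x y - qcnj (form A y x)"

lemma skew_form_simps:
  "skew_form A x (y + z) = skew_form A x y + skew_form A x z"
  "skew_form A (x + y) z = skew_form A x z + skew_form A y z"
  "skew_form A x (rscale y p) = skew_form A x y * p"
  "skew_form A (rscale x p) y = qcnj p * skew_form A x y"
  by (simp_all add: skew_form_def form_add_left form_add_right form_rscale_left form_rscale_right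
      qcnj_mult algebra_simps)

lemma skew_form_commute: "skew_form A y x = - qcnj (skew_form A x y)"
  by (simp add: skew_form_def quat_eq_iff)

lemma quat_inverse:
  fixes c :: quat
  assumes "c \<noteq> 0"
  obtains d where "c * d = 1"
proof
  show "c * ((1 / (norm c)\<^sup>2) *\<^sub>R qcnj c) = 1"
    using assms by (simp add: mult_qcnj_self of_real_def)
qed

text \<open>
  One step of Gram-Schmidt for the skew-Hermitian form, which works as soon as the vector to
  be split off is not isotropic.
\<close>
lemma skew_orthogonal_basis_anisotropic:
  assumes "skew_form A x x \<noteq> 0"
  obtains w where "skew_form A x w = 0" "y \<in> rspan2 x w"
proof -
  obtain k where k: "skew_form A x x * k = 1"
    using quat_inverse[OF assms] by blast
  define c where "c = k * skew_form A x y"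
  define w where "w = y + rscale x (- c)"
  have "skew_form A x x * c = skew_form A x y"
    unfolding c_def by (simp add: k flip: mult.assoc)
  then have "skew_form A x w = 0"
    by (simp add: w_def skew_form_simps)
  moreover have "y = w + rscale x c"
    by (simp add: w_def add.assoc flip: rscale_add)
  then have "y \<in> rspan2 x w"
    using rspan2_add rspan2_base rspan2_rscale by metis
  ultimately show ?thesis using that by blast
qed

text \<open>
  With \<open>c\<close> chosen such that the mixed value becomes \<open>i\<close>, the value at \<open>x + y c\<close> is \<open>i - i\<^sup>* = 2 i\<close>.
\<close>
lemma skew_form_polarize:
  assumes "skew_form A x x = 0" "skew_form A y y = 0" "skew_form A x y \<noteq> 0"
  obtains c where "skew_form A (x + rscale y c) (x + rscale y c) \<noteq> 0"
proof -
  obtain k where k: "skew_form A x y * k = 1"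
    using quat_inverse[OF assms(3)] by blast
  define c where "c = k * qi"
  have c: "skew_form A x y * c = qi"
    unfolding c_def by (simp add: k flip: mult.assoc)
  have "skew_form A (x + rscale y c) (x + rscale y c) = skew_form A x y * c - qcnj (skew_form A x y * c)"
    using assms by (simp add: skew_form_simps skew_form_commute[of A y x] qcnj_mult algebra_simps)
  also have "\<dots> \<noteq> 0"
    unfolding c by (simp add: qi_def quat_eq_iff)
  finally show ?thesis by (rule that)
qed

text \<open>
  If both vectors are isotropic without being orthogonal, adding a multiple of the second
  vector to the first makes the first anisotropic and leaves the span unchanged.
\<close>
lemma skew_orthogonal_basis:
  obtains z w where "skew_form A z w = 0" "x \<in> rspan2 z w" "y \<in> rspan2 z w"
proof -
  consider "skew_form A x x \<noteq> 0" | "skew_form A y y \<noteq> 0" | "skew_form A x y = 0"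
    | "skew_form A x x = 0" "skew_form A y y = 0" "skew_form A x y \<noteq> 0" by blast
  then show ?thesis
  proof cases
    case 1
    then show ?thesis
      using skew_orthogonal_basis_anisotropic that rspan2_base by metis
  next
    case 2
    then show ?thesis
      using skew_orthogonal_basis_anisotropic that rspan2_base by metis
  next
    case 3
    then show ?thesis using that rspan2_base by blast
  next
    case 4
    obtain c where c: "skew_form A (x + rscale y c) (x + rscale y c) \<noteq> 0"
      using skew_form_polarize[OF 4] by blast
    define x' where "x' = x + rscale y c"
    have "skew_form A x' x' \<noteq> 0" using c by (simp add: x'_def)
    then obtain w where w: "skew_form A x' w = 0" "y \<in> rspan2 x' w"
      using skew_orthogonal_basis_anisotropic by blast
    have "x = x' + rscale y (- c)"
      by (simp add: x'_def add.assoc flip: rscale_add)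
    then have "x \<in> rspan2 x' w"
      using rspan2_add rspan2_base rspan2_rscale w(2) by metis
    with w that show ?thesis by blast
  qed
qed

lemma rspan2_unit_rescale:
  assumes "norm p = 1" "norm q = 1"
  shows "rspan2 (rscale z p) (rscale w q) = rspan2 z w"
proof
  show "rspan2 (rscale z p) (rscale w q) \<subseteq> rspan2 z w"
    unfolding rspan2_def by (auto simp: rscale_rscale)
  have "rscale z r = rscale (rscale z p) (qcnj p * r)" "rscale w r = rscale (rscale w q) (qcnj q * r)" for r
    using assms by (simp_all add: rscale_rscale mult_qcnj_self flip: mult.assoc)
  then show "rspan2 z w \<subseteq> rspan2 (rscale z p) (rscale w q)"
    unfolding rspan2_def by clarify metis
qed

text \<open>
  Rescaling the two vectors by unit quaternions changes neither their span nor their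
  orthogonality, and it rotates the two diagonal values into the upper half plane.
\<close>
lemma skew_diagonal_basis:
  obtains z w a b \<alpha> \<beta> where "form A z w = qcnj (form A w z)" "form A z z = cpt a \<alpha>"
    "form A w w = cpt b \<beta>" "0 \<le> \<alpha>" "0 \<le> \<beta>" "x \<in> rspan2 z w" "y \<in> rspan2 z w"
proof -
  obtain z w where zw: "skew_form A z w = 0" "x \<in> rspan2 z w" "y \<in> rspan2 z w"
    by (rule skew_orthogonal_basis)
  obtain p where p: "norm p = 1" "qcnj p * form A z z * p = cpt (qRe (form A z z)) (norm (qIm (form A z z)))"
    by (rule rotate_to_cpt)
  obtain q where q: "norm q = 1" "qcnj q * form A w w * q = cpt (qRe (form A w w)) (norm (qIm (form A w w)))"
    by (rule rotate_to_cpt)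
  have "skew_form A (rscale z p) (rscale w q) = 0"
    by (simp add: skew_form_simps zw)
  moreover have "x \<in> rspan2 (rscale z p) (rscale w q)" "y \<in> rspan2 (rscale z p) (rscale w q)"
    using zw by (simp_all add: rspan2_unit_rescale p q)
  ultimately show ?thesis
    using p q by (intro that[of "rscale z p" "rscale w q"])
      (auto simp: skew_form_def form_rscale_left form_rscale_right mult.assoc)
qed

text \<open>
  By axial symmetry this is the part of the numerical range in the upper half plane of \<open>\<complex>\<close>, with
  \<open>x + i y\<close> written as \<open>(x, y)\<close>.
\<close>
definition upper_bild :: "quat^'n^'n \<Rightarrow> (real \<times> real) set" where
  "upper_bild A = (\<lambda>w. (qRe w, norm (qIm w))) ` numerical_range A"

lemma qRe_form_one: "qRe (form (mat 1) x x) = (norm x)\<^sup>2"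
  by (simp only: form_mat_1 star_prod_self quat_of_real_sel(1))

text \<open>
  The convexity theorem of So and Thompson. On the span of two vectors, in a basis that
  diagonalizes the skew-Hermitian part, the squared norm and the real part are linear in the
  Gram data and the length of the imaginary part is the lower norm. So the theorem reduces to
  the convexity of the joint range of these three functions on rank-one matrices.
\<close>
theorem convex_upper_bild: "convex (upper_bild A)"
  unfolding convex_def
proof (intro ballI allI impI)
  fix X Y s t assume XY: "X \<in> upper_bild A" "Y \<in> upper_bild A" and st: "0 \<le> s" "0 \<le> t" "s + t = (1::real)"
  obtain x y where xy: "norm x = 1" "norm y = 1"
    "X = (qRe (form A x x), norm (qIm (form A x x)))" "Y = (qRe (form A y y), norm (qIm (form A y y)))"
    using XY by (auto simp: upper_bild_def numerical_range_eq)
  obtain z w a b \<alpha> \<beta> where zw: "form A z w = qcnj (form A w z)" "form A z z = cpt a \<alpha>"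
    "form A w w = cpt b \<beta>" "0 \<le> \<alpha>" "0 \<le> \<beta>" and span: "x \<in> rspan2 z w" "y \<in> rspan2 z w"
    by (rule skew_diagonal_basis)
  let ?v = "\<lambda>p q. rscale z p + rscale w q"
  obtain p1 q1 p2 q2 where pq: "x = ?v p1 q1" "y = ?v p2 q2"
    using span by (auto simp: rspan2_def)
  define f where "f M = gram_functional (qRe (form M z z)) (qRe (form M w w)) (form M z w + qcnj (form M w z))"
    for M :: "quat^'a^'a"
  have f: "qRe (form M (?v p q) (?v p q)) = f M (gram_of p q)" for M p q
    unfolding f_def by (rule qRe_form_pencil)
  have low: "norm (qIm (form A (?v p q) (?v p q))) = lower_norm \<alpha> \<beta> (gram_of p q)" for p q
    by (rule norm_qIm_form_pencil[OF zw])
  have lin: "linear (f M)" for M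
    unfolding f_def by (rule linear_gram_functional)
  obtain u where u: "u \<in> gram_null"
    "f (mat 1) u = s * f (mat 1) (gram_of p1 q1) + t * f (mat 1) (gram_of p2 q2)"
    "f A u = s * f A (gram_of p1 q1) + t * f A (gram_of p2 q2)"
    "lower_norm \<alpha> \<beta> u = s * lower_norm \<alpha> \<beta> (gram_of p1 q1) + t * lower_norm \<alpha> \<beta> (gram_of p2 q2)"
    using gram_null_joint_convex[OF zw(4,5) lin lin _ _ st] gram_null_iff by metis
  then obtain p q where upq: "u = gram_of p q" using gram_null_iff by blast
  have "(norm (?v p q))\<^sup>2 = s * (norm x)\<^sup>2 + t * (norm y)\<^sup>2"
    using u(2) unfolding upq pq f[symmetric] qRe_form_one .
  then have "norm (?v p q) = 1"
    using xy st by (simp add: power2_eq_1_iff) (metis norm_ge_zero neg_0_le_iff_le not_one_le_zero)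
  then have "(qRe (form A (?v p q) (?v p q)), norm (qIm (form A (?v p q) (?v p q)))) \<in> upper_bild A"
    unfolding upper_bild_def numerical_range_eq by blast
  moreover have "(qRe (form A (?v p q) (?v p q)), norm (qIm (form A (?v p q) (?v p q)))) = s *\<^sub>R X + t *\<^sub>R Y"
    using u(3,4) unfolding xy upq f low pq by simp
  ultimately show "s *\<^sub>R X + t *\<^sub>R Y \<in> upper_bild A" by simp
qed

section \<open>One-sided derivatives and the kite\<close>

text \<open>
  The difference quotients of a convex function at \<open>0\<close> increase towards \<open>0\<close>, so their limit from
  the left is their supremum. This form of the derivative is what the geometry of supporting
  lines uses, and it is meaningful when the value is infinite.
\<close>
lemma slope_tendsto_at_left:
  assumes "c < 0" "convex_on {c..0} f"
  shows "((\<lambda>y. ereal ((f y - f 0) / y)) \<longlongrightarrow> (SUP y\<in>{c..<0}. ereal ((f y - f 0) / y))) (at_left 0)"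
proof -
  define g where "g y = (f y - f 0) / y" for y
  define S where "S = (SUP y\<in>{c..<0}. ereal (g y))"
  have mono: "g y \<le> g y'" if "c \<le> y" "y \<le> y'" "y' < 0" for y y'
  proof (cases "y = y'")
    case False
    then show ?thesis
      using convex_on_slope_le(2)[OF assms(2), of y 0 y'] convex_on_slope_le(1)[OF assms(2), of y 0 y'] that
      by (simp add: g_def)
  qed simp
  have ev: "\<forall>\<^sub>F y in at_left 0. y1 < y \<and> y < 0" if "y1 < 0" for y1 :: real
    using that by (auto simp: eventually_at_left[OF that])
  have "((\<lambda>y. ereal (g y)) \<longlongrightarrow> S) (at_left 0)"
  proof (rule order_tendstoI)
    fix e assume "e < S"
    then obtain y1 where y1: "y1 \<in> {c..<0}" "e < ereal (g y1)"
      unfolding S_def less_SUP_iff by blast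
    have "\<forall>\<^sub>F y in at_left 0. y1 < y \<and> y < 0"
      using ev y1 by simp
    then show "\<forall>\<^sub>F y in at_left 0. e < ereal (g y)"
    proof eventually_elim
      case (elim y)
      then have "g y1 \<le> g y" using mono y1 by simp
      then show ?case using y1(2) by (meson ereal_less_eq(3) less_le_trans)
    qed
  next
    fix e assume "S < e"
    have "\<forall>\<^sub>F y in at_left 0. c < y \<and> y < 0"
      using ev assms by simp
    then show "\<forall>\<^sub>F y in at_left 0. ereal (g y) < e"
    proof eventually_elim
      case (elim y)
      then have "ereal (g y) \<le> S" unfolding S_def by (intro SUP_upper) simp
      then show ?case using \<open>S < e\<close> by simp
    qed
  qed
  then show ?thesis by (simp add: g_def S_def)
qed

lemma left_deriv_convex:
  assumes "c < 0" "convex_on {c..0} f"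
  shows "left_deriv f 0 = (SUP y\<in>{c..<0}. ereal ((f y - f 0) / y))"
  using tendsto_Lim[OF _ slope_tendsto_at_left[OF assms]]
  by (simp add: left_deriv_def trivial_limit_at_left_real)

lemma left_deriv_concave:
  assumes "c < 0" "convex_on {c..0} (\<lambda>y. - f y)"
  shows "left_deriv f 0 = (INF y\<in>{c..<0}. ereal ((f y - f 0) / y))"
proof -
  have neg: "ereal ((- f y - - f 0) / y) = - ereal ((f y - f 0) / y)" for y
    by (simp add: divide_simps)
  have "((\<lambda>y. - ereal ((f y - f 0) / y)) \<longlongrightarrow> - (INF y\<in>{c..<0}. ereal ((f y - f 0) / y))) (at_left 0)"
    using slope_tendsto_at_left[OF assms] unfolding neg ereal_SUP_uminus_eq .
  then have "((\<lambda>y. ereal ((f y - f 0) / y)) \<longlongrightarrow> (INF y\<in>{c..<0}. ereal ((f y - f 0) / y))) (at_left 0)"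
    using ereal_Lim_uminus by blast
  from tendsto_Lim[OF _ this] show ?thesis
    by (simp add: left_deriv_def trivial_limit_at_left_real)
qed

text \<open>
  Each point of the kite lies on a segment from a point of its horizontal diagonal to the
  upper or the lower tip. Conversely, the two bounds on \<open>x\<close> define a convex set because of the
  signs of the slopes.
\<close>
lemma convex_hull_kite:
  assumes "m \<le> M" "b \<le> 0" "0 \<le> a" "b < a" "0 \<le> y0" "m + a * y0 = x0" "M + b * y0 = x0"
  shows "convex hull {cpt m 0, cpt M 0, cpt x0 y0, cpt x0 (- y0)} =
    {cpt x y | x y. m + a * \<bar>y\<bar> \<le> x \<and> x \<le> M + b * \<bar>y\<bar>}" (is "?H = ?K")
proof
  have cpt_comb: "s *\<^sub>R cpt x y + t *\<^sub>R cpt x' y' = cpt (s * x + t * x') (s * y + t * y')" for s t x y x' y'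
    by (simp add: cpt_eq_Quat quat_eq_iff)
  show "?K \<subseteq> ?H"
  proof safe
    fix x y assume xy: "m + a * \<bar>y\<bar> \<le> x" "x \<le> M + b * \<bar>y\<bar>"
    have "(a - b) * \<bar>y\<bar> \<le> (a - b) * y0" using xy assms by (simp add: algebra_simps)
    then have y: "\<bar>y\<bar> \<le> y0" using assms by simp
    have mM: "cpt c 0 \<in> ?H" if "m \<le> c" "c \<le> M" for c
    proof -
      have "c \<in> closed_segment m M" using that by (simp add: closed_segment_eq_real_ivl)
      then obtain u where u: "0 \<le> u" "u \<le> 1" "c = (1 - u) * m + u * M"
        by (auto simp: in_segment)
      have "(1 - u) *\<^sub>R cpt m 0 + u *\<^sub>R cpt M 0 \<in> ?H"
        using u by (intro convexD_alt convex_convex_hull hull_inc) auto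
      then show ?thesis by (simp add: cpt_comb u)
    qed
    define tip where "tip = (if 0 \<le> y then y0 else - y0)"
    have tip: "cpt x0 tip \<in> ?H" by (auto simp: tip_def hull_inc)
    show "cpt x y \<in> ?H"
    proof (cases "y0 = 0 \<or> \<bar>y\<bar> = y0")
      case True
      then have "cpt x y = cpt x0 tip \<or> (y = 0 \<and> m \<le> x \<and> x \<le> M)"
        using xy assms y by (auto simp: tip_def)
      then show ?thesis using tip mM by auto
    next
      case False
      define s where "s = \<bar>y\<bar> / y0"
      have s: "0 \<le> s" "s < 1" "s * y0 = \<bar>y\<bar>" "s * tip = y"
        using False y assms by (auto simp: s_def tip_def)
      \<comment> \<open>The line through the tip and \<open>(x, y)\<close> meets the real axis in \<open>c\<close>.\<close>
      define c where "c = (x - s * x0) / (1 - s)"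
      have c: "(1 - s) * c + s * x0 = x" using s by (simp add: c_def)
      have "s * (m + a * y0) = s * m + a * (s * y0)" "s * (M + b * y0) = s * M + b * (s * y0)"
        by (simp_all add: algebra_simps)
      then have "s * x0 = s * m + a * \<bar>y\<bar>" "s * x0 = s * M + b * \<bar>y\<bar>"
        unfolding assms(6,7) s(3) .
      then have "m \<le> c" "c \<le> M"
        using xy s by (simp_all add: c_def field_simps)
      then have "(1 - s) *\<^sub>R cpt c 0 + s *\<^sub>R cpt x0 tip \<in> ?H"
        using s tip mM by (intro convexD_alt convex_convex_hull) auto
      then show ?thesis by (simp add: cpt_comb c s)
    qed
  qed
  have K: "cpt x y \<in> ?K" if "m + a * \<bar>y\<bar> \<le> x" "x \<le> M + b * \<bar>y\<bar>" for x y
    using that by blast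
  show "?H \<subseteq> ?K"
  proof (rule hull_minimal)
    show "{cpt m 0, cpt M 0, cpt x0 y0, cpt x0 (- y0)} \<subseteq> ?K"
      using K[of 0 m] K[of 0 M] K[of y0 x0] K[of "- y0" x0] assms by simp
    show "convex ?K"
      unfolding convex_def
    proof clarify
      fix s t x y x' y' :: real
      assume st: "0 \<le> s" "0 \<le> t" "s + t = 1"
        and 1: "m + a * \<bar>y\<bar> \<le> x" "x \<le> M + b * \<bar>y\<bar>" and 2: "m + a * \<bar>y'\<bar> \<le> x'" "x' \<le> M + b * \<bar>y'\<bar>"
      show "\<exists>xa ya. s *\<^sub>R cpt x y + t *\<^sub>R cpt x' y' = cpt xa ya \<and> m + a * \<bar>ya\<bar> \<le> xa \<and> xa \<le> M + b * \<bar>ya\<bar>"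
      proof (intro exI conjI)
        have tri: "\<bar>s * y + t * y'\<bar> \<le> s * \<bar>y\<bar> + t * \<bar>y'\<bar>"
          using abs_triangle_ineq[of "s * y" "t * y'"] st by (simp add: abs_mult)
        have "m + a * \<bar>s * y + t * y'\<bar> \<le> (s + t) * m + a * (s * \<bar>y\<bar> + t * \<bar>y'\<bar>)"
          using mult_left_mono[OF tri assms(3)] st by simp
        also have "\<dots> = s * (m + a * \<bar>y\<bar>) + t * (m + a * \<bar>y'\<bar>)"
          by (simp add: algebra_simps)
        also have "\<dots> \<le> s * x + t * x'"
          using 1 2 st by (intro add_mono mult_left_mono) auto
        finally show "m + a * \<bar>s * y + t * y'\<bar> \<le> s * x + t * x'" .
        have "s * x + t * x' \<le> s * (M + b * \<bar>y\<bar>) + t * (M + b * \<bar>y'\<bar>)"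
          using 1 2 st by (intro add_mono mult_left_mono) auto
        also have "\<dots> = (s + t) * M + b * (s * \<bar>y\<bar> + t * \<bar>y'\<bar>)"
          by (simp add: algebra_simps)
        also have "\<dots> \<le> M + b * \<bar>s * y + t * y'\<bar>"
          using mult_left_mono_neg[OF tri assms(2)] st by simp
        finally show "s * x + t * x' \<le> M + b * \<bar>s * y + t * y'\<bar>" .
      qed (rule cpt_comb)
    qed
  qed
qed

section \<open>The star-center of an axially symmetric set\<close>

text \<open>
  A segment joining a point \<open>(x, y)\<close> of the plane with a point on the other side of the real
  axis, at height \<open>r\<close> and abscissa \<open>x'\<close>, crosses the axis at \<open>(r x + \<bar>y\<bar> x') / (r + \<bar>y\<bar>)\<close>. The two
  inequalities say, with denominators cleared, that all these crossings belong to \<open>[m, M]\<close>. This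
  is plainly necessary. It is sufficient because the two halves of such a segment then lie in
  \<open>D\<close> and in its mirror image, and because on the segment to any other rotation of \<open>(x', r)\<close> the
  length of the imaginary part lies, at each parameter, between its values for the opposite
  and for the same side.
\<close>
lemma star_center_axial_iff:
  fixes W :: "quat set" and D :: "(real \<times> real) set"
  assumes W: "\<And>w. w \<in> W \<longleftrightarrow> (qRe w, norm (qIm w)) \<in> D"
    and D: "convex D" "\<And>x r. (x, r) \<in> D \<Longrightarrow> 0 \<le> r"
    and mM: "\<And>t. (t, 0) \<in> D \<longleftrightarrow> m \<le> t \<and> t \<le> M"
  shows "cpt x y \<in> star_center W \<longleftrightarrow> (x, \<bar>y\<bar>) \<in> D \<and>
    (\<forall>(x', r)\<in>D. m * (r + \<bar>y\<bar>) \<le> r * x + \<bar>y\<bar> * x' \<and> r * x + \<bar>y\<bar> * x' \<le> M * (r + \<bar>y\<bar>))"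
    (is "?L \<longleftrightarrow> ?R")
proof
  have cpt: "cpt x' y' \<in> W \<longleftrightarrow> (x', \<bar>y'\<bar>) \<in> D" for x' y'
    by (simp add: W qRe_cpt norm_qIm_cpt)
  {
    assume L: ?L
    show ?R
    proof (intro conjI ballI, safe)
      show "(x, \<bar>y\<bar>) \<in> D" using L cpt by (simp add: star_center_def)
    next
      fix x' r assume d: "(x', r) \<in> D"
      have r: "0 \<le> r" using D(2) d .
      define S where "S = r + \<bar>y\<bar>"
      have goal: "m * S \<le> r * x + \<bar>y\<bar> * x' \<and> r * x + \<bar>y\<bar> * x' \<le> M * S"
      proof (cases "S = 0")
        case True
        then have "r = 0" "y = 0" using r by (auto simp: S_def)
        then show ?thesis using True by simp
      next
        case False
        then have S: "S > 0" using r by (simp add: S_def)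
        define \<alpha> where "\<alpha> = \<bar>y\<bar> / S"
        have \<alpha>: "0 \<le> \<alpha>" "\<alpha> \<le> 1" "1 - \<alpha> = r / S"
          using S r by (auto simp: \<alpha>_def S_def field_simps)
        define y' where "y' = (if 0 \<le> y then - r else r)"
        have "cpt x' y' \<in> W" using d r by (auto simp: cpt y'_def)
        then have "(1 - \<alpha>) *\<^sub>R cpt x y + \<alpha> *\<^sub>R cpt x' y' \<in> W"
          using L \<alpha>(1,2) by (simp add: star_center_def)
        moreover have "(1 - \<alpha>) *\<^sub>R cpt x y + \<alpha> *\<^sub>R cpt x' y' = cpt ((r * x + \<bar>y\<bar> * x') / S) 0"
          unfolding \<alpha>(3) by (auto simp: cpt_eq_Quat quat_eq_iff \<alpha>_def y'_def add_divide_distrib diff_divide_distrib mult.commute)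
        ultimately have "((r * x + \<bar>y\<bar> * x') / S, 0) \<in> D" by (simp add: cpt)
        then show ?thesis using S by (simp add: mM field_simps)
      qed
      show "m * (r + \<bar>y\<bar>) \<le> r * x + \<bar>y\<bar> * x'" "r * x + \<bar>y\<bar> * x' \<le> M * (r + \<bar>y\<bar>)"
        using goal by (simp_all add: S_def)
    qed
  }
  assume R: ?R
  then have xy: "(x, \<bar>y\<bar>) \<in> D" by simp
  have comb: "((1 - u) * x1 + u * x2, (1 - u) * r1 + u * r2) \<in> D"
    if "(x1, r1) \<in> D" "(x2, r2) \<in> D" "0 \<le> u" "u \<le> 1" for x1 r1 x2 r2 u
    using convexD_alt[OF D(1) that] by simp
  show ?L
    unfolding star_center_def
  proof (intro CollectI conjI ballI)
    show "cpt x y \<in> W" using xy cpt by simp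
  next
    fix s \<alpha> assume s: "s \<in> W" and "\<alpha> \<in> {0..1::real}"
    then have \<alpha>: "0 \<le> \<alpha>" "\<alpha> \<le> 1" by auto
    define w where "w = (1 - \<alpha>) *\<^sub>R cpt x y + \<alpha> *\<^sub>R s"
    define x' r where "x' = qRe s" and "r = norm (qIm s)"
    have d: "(x', r) \<in> D" using s W by (simp add: x'_def r_def)
    have r: "0 \<le> r" by (simp add: r_def)
    define X \<rho> where "X = (1 - \<alpha>) * x + \<alpha> * x'" and "\<rho> = norm (qIm w)"
    have up: "(X, (1 - \<alpha>) * \<bar>y\<bar> + \<alpha> * r) \<in> D"
      unfolding X_def by (rule comb[OF xy d \<alpha>])
    have w: "qRe w = X" "qIm w = (1 - \<alpha>) *\<^sub>R qIm (cpt x y) + \<alpha> *\<^sub>R qIm s"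
      by (simp_all add: w_def X_def x'_def cpt_eq_Quat quat_eq_iff)
    have n: "norm ((1 - \<alpha>) *\<^sub>R qIm (cpt x y)) = (1 - \<alpha>) * \<bar>y\<bar>" "norm (\<alpha> *\<^sub>R qIm s) = \<alpha> * r"
      using \<alpha> by (simp_all add: r_def norm_qIm_cpt)
    have \<rho>1: "\<rho> \<le> (1 - \<alpha>) * \<bar>y\<bar> + \<alpha> * r"
      unfolding \<rho>_def w(2) using norm_triangle_ineq n by metis
    have \<rho>0: "\<bar>(1 - \<alpha>) * \<bar>y\<bar> - \<alpha> * r\<bar> \<le> \<rho>"
      unfolding \<rho>_def w(2) using norm_diff_ineq norm_triangle_ineq3[of "(1 - \<alpha>) *\<^sub>R qIm (cpt x y)" "- (\<alpha> *\<^sub>R qIm s)"] n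
      by simp
    \<comment> \<open>The point of the planar segment to the opposite side of the axis.  It lies on the part before or
       after the crossing point \<open>c\<close>, that is, on a segment from \<open>(c, 0)\<close> to \<open>(x, |y|)\<close> or to \<open>(x', r)\<close>.\<close>
    have low: "(X, \<bar>(1 - \<alpha>) * \<bar>y\<bar> - \<alpha> * r\<bar>) \<in> D"
    proof (cases "y = 0 \<or> r = 0")
      case True
      then have "\<bar>(1 - \<alpha>) * \<bar>y\<bar> - \<alpha> * r\<bar> = (1 - \<alpha>) * \<bar>y\<bar> + \<alpha> * r"
        using \<alpha> r by auto
      then show ?thesis using up by simp
    next
      case False
      then have pos: "0 < \<bar>y\<bar>" "0 < r" using r by auto
      define c where "c = (r * x + \<bar>y\<bar> * x') / (r + \<bar>y\<bar>)"
      have "m * (r + \<bar>y\<bar>) \<le> r * x + \<bar>y\<bar> * x'" "r * x + \<bar>y\<bar> * x' \<le> M * (r + \<bar>y\<bar>)"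
        using R d by auto
      then have c: "(c, 0) \<in> D"
        using pos by (simp add: mM c_def field_simps)
      have cS: "c * (r + \<bar>y\<bar>) = r * x + \<bar>y\<bar> * x'" using pos by (simp add: c_def)
      show ?thesis
      proof (cases "\<alpha> * r \<le> (1 - \<alpha>) * \<bar>y\<bar>")
        case True
        define u where "u = \<alpha> * (r + \<bar>y\<bar>) / \<bar>y\<bar>"
        have u: "0 \<le> u" "u \<le> 1" "u * \<bar>y\<bar> = \<alpha> * (r + \<bar>y\<bar>)"
          using True pos \<alpha> by (simp_all add: u_def field_simps)
        have "\<bar>y\<bar> * ((1 - u) * x + u * c) = \<bar>y\<bar> * X"
          using u(3) cS unfolding X_def by algebra
        then have "(1 - u) * x + u * c = X" using pos by simp
        moreover have "(1 - u) * \<bar>y\<bar> + u * 0 = \<bar>(1 - \<alpha>) * \<bar>y\<bar> - \<alpha> * r\<bar>"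
          using True u(3) by (simp add: algebra_simps)
        ultimately show ?thesis using comb[OF xy c u(1,2)] by simp
      next
        case False
        define u where "u = (1 - \<alpha>) * (r + \<bar>y\<bar>) / r"
        have "0 \<le> u" using pos \<alpha> by (simp add: u_def)
        then have u: "0 \<le> u" "u \<le> 1" "u * r = (1 - \<alpha>) * (r + \<bar>y\<bar>)"
          using False pos \<alpha> by (simp_all add: u_def field_simps)
        have "r * ((1 - u) * x' + u * c) = r * X"
          using u(3) cS unfolding X_def by algebra
        then have "(1 - u) * x' + u * c = X" using pos by simp
        moreover have "(1 - u) * r + u * 0 = \<bar>(1 - \<alpha>) * \<bar>y\<bar> - \<alpha> * r\<bar>"
          using False u(3) by (simp add: algebra_simps)
        ultimately show ?thesis using comb[OF d c u(1,2)] by simp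
      qed
    qed
    \<comment> \<open>The vertical section of \<open>D\<close> at \<open>X\<close> is convex and contains both extreme heights.\<close>
    have "(X, \<rho>) \<in> D"
    proof -
      let ?a = "\<bar>(1 - \<alpha>) * \<bar>y\<bar> - \<alpha> * r\<bar>" and ?b = "(1 - \<alpha>) * \<bar>y\<bar> + \<alpha> * r"
      have "\<rho> \<in> closed_segment ?a ?b"
        using \<rho>0 \<rho>1 by (simp add: closed_segment_eq_real_ivl)
      then obtain u where u: "0 \<le> u" "u \<le> 1" "\<rho> = (1 - u) * ?a + u * ?b"
        by (auto simp: in_segment)
      have "(1 - u) * X + u * X = X" by (simp add: algebra_simps)
      then show ?thesis using comb[OF low up u(1,2)] u(3) by simp
    qed
    then show "(1 - \<alpha>) *\<^sub>R cpt x y + \<alpha> *\<^sub>R s \<in> W"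
      unfolding w_def[symmetric] W by (simp add: w \<rho>_def)
  qed
qed

text \<open>
  Here \<open>f\<close> is the left boundary curve of \<open>D\<close>, reflected into the lower half plane. Among all
  points at one height the crossing is leftmost for the boundary point, and for boundary
  points the crossing condition compares a difference quotient of \<open>f\<close> with \<open>(x - f 0) / \<bar>y\<bar>\<close>.
\<close>
lemma support_slope_left_iff:
  assumes f: "\<And>\<eta>. \<eta> \<in> {c..0} \<Longrightarrow> (f \<eta>, - \<eta>) \<in> D"
    and D: "\<And>x' r. (x', r) \<in> D \<Longrightarrow> r \<in> {0..- c} \<and> f (- r) \<le> x'"
    and y: "y \<noteq> 0"
  shows "(\<forall>(x', r)\<in>D. f 0 * (r + \<bar>y\<bar>) \<le> r * x + \<bar>y\<bar> * x') \<longleftrightarrow>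
    (SUP \<eta>\<in>{c..<0}. ereal ((f \<eta> - f 0) / \<eta>)) \<le> ereal ((x - f 0) / \<bar>y\<bar>)"
    (is "?L \<longleftrightarrow> ?S \<le> ?q")
proof
  assume L: ?L
  show "?S \<le> ?q"
  proof (rule SUP_least)
    fix \<eta> assume \<eta>: "\<eta> \<in> {c..<0}"
    then have "f 0 * (- \<eta> + \<bar>y\<bar>) \<le> - \<eta> * x + \<bar>y\<bar> * f \<eta>"
      using L f[of \<eta>] by fastforce
    then have "(f \<eta> - f 0) / \<eta> \<le> (x - f 0) / \<bar>y\<bar>"
      using \<eta> y by (simp add: divide_simps) (simp add: algebra_simps)
    then show "ereal ((f \<eta> - f 0) / \<eta>) \<le> ?q" by simp
  qed
next
  assume S: "?S \<le> ?q"
  show ?L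
  proof safe
    fix x' r assume d: "(x', r) \<in> D"
    show "f 0 * (r + \<bar>y\<bar>) \<le> r * x + \<bar>y\<bar> * x'"
    proof (cases "r = 0")
      case True
      then show ?thesis using D[OF d] mult_left_mono[of "f 0" x' "\<bar>y\<bar>"] by (simp add: mult.commute)
    next
      case False
      then have r: "0 < r" "- r \<in> {c..<0}" using D[OF d] by auto
      then have "ereal ((f (- r) - f 0) / (- r)) \<le> ?S" by (intro SUP_upper)
      then have "ereal ((f (- r) - f 0) / (- r)) \<le> ?q" using S by (rule order_trans)
      then have "(f 0 - f (- r)) / r \<le> (x - f 0) / \<bar>y\<bar>"
        using minus_divide_left[of "f (- r) - f 0" r] by simp
      then have "\<bar>y\<bar> * (f 0 - f (- r)) \<le> r * (x - f 0)"
        using r y by (simp add: divide_simps) (simp add: algebra_simps)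
      moreover have "\<bar>y\<bar> * f (- r) \<le> \<bar>y\<bar> * x'"
        using D[OF d] by (simp add: mult_left_mono)
      ultimately show ?thesis by (simp add: algebra_simps)
    qed
  qed
qed

text \<open>
  The mirror image of the preceding lemma under \<open>(x, y) \<mapsto> (- x, y)\<close>.
\<close>
lemma support_slope_right_iff:
  assumes f: "\<And>\<eta>. \<eta> \<in> {c..0} \<Longrightarrow> (f \<eta>, - \<eta>) \<in> D"
    and D: "\<And>x' r. (x', r) \<in> D \<Longrightarrow> r \<in> {0..- c} \<and> x' \<le> f (- r)"
    and y: "y \<noteq> 0"
  shows "(\<forall>(x', r)\<in>D. r * x + \<bar>y\<bar> * x' \<le> f 0 * (r + \<bar>y\<bar>)) \<longleftrightarrow>
    ereal ((x - f 0) / \<bar>y\<bar>) \<le> (INF \<eta>\<in>{c..<0}. ereal ((f \<eta> - f 0) / \<eta>))"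
proof -
  let ?D = "(\<lambda>(x, r). (- x, r)) ` D"
  have "(\<forall>(x', r)\<in>?D. - f 0 * (r + \<bar>y\<bar>) \<le> r * (- x) + \<bar>y\<bar> * x') \<longleftrightarrow>
    (SUP \<eta>\<in>{c..<0}. ereal ((- f \<eta> - - f 0) / \<eta>)) \<le> ereal ((- x - - f 0) / \<bar>y\<bar>)"
    by (rule support_slope_left_iff) (use f D y in force)+
  moreover have "(\<forall>(x', r)\<in>?D. - f 0 * (r + \<bar>y\<bar>) \<le> r * (- x) + \<bar>y\<bar> * x') \<longleftrightarrow>
    (\<forall>(x', r)\<in>D. r * x + \<bar>y\<bar> * x' \<le> f 0 * (r + \<bar>y\<bar>))"
    by (auto simp: algebra_simps)
  moreover have "ereal ((- u - - f 0) / v) = - ereal ((u - f 0) / v)" for u v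
    by (simp add: divide_simps)
  ultimately show ?thesis
    by (simp only: ereal_SUP_uminus_eq ereal_minus_le_minus)
qed

section \<open>Real and nonreal points of the numerical range\<close>

lemma mem_numerical_range_iff:
  "w \<in> numerical_range A \<longleftrightarrow> (qRe w, norm (qIm w)) \<in> upper_bild A"
proof
  assume "(qRe w, norm (qIm w)) \<in> upper_bild A"
  then obtain w' where "w' \<in> numerical_range A" "qRe w' = qRe w" "norm (qIm w') = norm (qIm w)"
    by (auto simp: upper_bild_def)
  then show "w \<in> numerical_range A"
    using numerical_range_cpt_iff[of w A] numerical_range_cpt_iff[of w' A] by simp
qed (simp add: upper_bild_def)

lemma cpt_mem_numerical_range_iff:
  "cpt x y \<in> numerical_range A \<longleftrightarrow> (x, \<bar>y\<bar>) \<in> upper_bild A"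
  by (simp add: mem_numerical_range_iff[of "cpt x y"] qRe_cpt norm_qIm_cpt)

lemma continuous_on_qRe: "continuous_on S qRe"
  by (intro linear_continuous_on linear_linear[THEN iffD2] linearI) simp_all

lemma compact_upper_bild: "compact (upper_bild A)"
proof -
  have "linear qIm" by (rule linearI) (simp_all add: quat_eq_iff)
  then have "continuous_on S qIm" for S
    by (simp add: linear_continuous_on linear_linear)
  then have "continuous_on (numerical_range A) (\<lambda>w. (qRe w, norm (qIm w)))"
    by (intro continuous_intros continuous_on_qRe)
  then show ?thesis
    unfolding upper_bild_def by (rule compact_continuous_image) (rule compact_numerical_range)
qed

lemma numerical_range_normalize:
  assumes "x \<noteq> 0"
  obtains c where "c > 0" "c *\<^sub>R form A x x \<in> numerical_range A"
proof -
  define k :: quat where "k = of_real (1 / norm x)"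
  have "norm (rscale x k) = 1"
    using assms by (simp add: norm_rscale k_def norm_quat_of_real)
  moreover have "form A (rscale x k) (rscale x k) = (1 / (norm x)\<^sup>2) *\<^sub>R form A x x"
    by (simp add: form_rscale_left form_rscale_right k_def quat_eq_iff power2_eq_square)
  ultimately have "(1 / (norm x)\<^sup>2) *\<^sub>R form A x x \<in> numerical_range A"
    unfolding numerical_range_eq by force
  then show ?thesis using that assms by (metis zero_less_divide_1_iff zero_less_norm_iff zero_less_power)
qed

text \<open>
  If \<open>z\<close> and \<open>w\<close> were dependent, their span would be a single quaternionic line, which cannot
  contain two vectors with the coordinates of distinct unit vectors.
\<close>
lemma rspan2_independent:
  assumes xy: "x \<in> rspan2 z w" "y \<in> rspan2 z w"
    and ij: "x $ i = 1" "x $ j = 0" "y $ i = 0" "y $ j = (1 :: quat)"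
    and zero: "rscale z p + rscale w q = 0"
  shows "p = 0 \<and> q = 0"
proof (rule ccontr)
  assume "\<not> (p = 0 \<and> q = 0)"
  have line: False if "x = rscale v c" "y = rscale v d" for v c d
  proof -
    have 1: "v $ i * c = 1" "v $ i * d = 0" "v $ j * d = 1"
      using that ij by (auto simp: rscale_def)
    then have "norm (v $ i) * norm d = 0" by (metis norm_quat_mult norm_zero)
    moreover have "v $ i \<noteq> 0" "d \<noteq> 0" using 1 by auto
    ultimately show False by simp
  qed
  have dep: False if "rscale z p + rscale w q = 0" "q \<noteq> 0" "x \<in> rspan2 z w" "y \<in> rspan2 z w" for z w p q
  proof -
    obtain k where k: "q * k = 1" using quat_inverse[OF \<open>q \<noteq> 0\<close>] by blast
    have "rscale w q = rscale z (- p)"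
    proof -
      have "rscale z (- p) + (rscale z p + rscale w q) = rscale w q"
        by (simp add: add.assoc[symmetric] flip: rscale_add)
      then show ?thesis using that by simp
    qed
    then have "rscale (rscale w q) k = rscale (rscale z (- p)) k" by simp
    then have "w = rscale z (- p * k)" by (simp add: rscale_rscale k)
    then have "\<exists>c. v = rscale z c" if "v \<in> rspan2 z w" for v
      using that unfolding rspan2_def by (auto simp: rscale_rscale simp flip: rscale_add)
    then show False using line that by metis
  qed
  have swap: "rspan2 z w = rspan2 w z"
    unfolding rspan2_def by (auto, metis add.commute, metis add.commute)
  show False
  proof (cases "q = 0")
    case False
    then show ?thesis using dep zero xy by blast
  next
    case True
    then have "p \<noteq> 0" using \<open>\<not> (p = 0 \<and> q = 0)\<close> by simp
    moreover have "rscale w q + rscale z p = 0" using zero by (simp add: add.commute)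
    ultimately show ?thesis using dep[of w q z p] xy swap by simp
  qed
qed

text \<open>
  In a diagonalizing basis the imaginary part at \<open>z p + w q\<close> is \<open>\<alpha> p\<^sup>* i p + \<beta> q\<^sup>* i q\<close>. Taking \<open>p\<close>
  real and \<open>q\<close> a multiple of \<open>j\<close> turns this into \<open>(\<alpha> \<bar>p\<bar>\<^sup>2 - \<beta> \<bar>q\<bar>\<^sup>2) i\<close>, which vanishes for suitable
  lengths.
\<close>
lemma numerical_range_meets_reals:
  fixes A :: "quat^'n^'n"
  assumes "CARD('n) \<ge> 2"
  obtains t where "(t, 0) \<in> upper_bild A"
proof -
  obtain i j :: 'n where ij: "i \<noteq> j"
    using assms by (metis card_2_iff' ex_card top_greatest subset_iff)
  define x :: "quat^'n" where "x = axis i 1"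
  define y :: "quat^'n" where "y = axis j 1"
  obtain z w a b \<alpha> \<beta> where zw: "form A z w = qcnj (form A w z)" "form A z z = cpt a \<alpha>"
    "form A w w = cpt b \<beta>" "0 \<le> \<alpha>" "0 \<le> \<beta>" and span: "x \<in> rspan2 z w" "y \<in> rspan2 z w"
    by (rule skew_diagonal_basis)
  obtain P Q where PQ: "0 \<le> P" "0 \<le> Q" "(Q, P) \<noteq> (0, 0)" "\<alpha> * P = \<beta> * Q"
    using level_weights[OF zw(4,5)] by metis
  define p q where "p = (of_real (sqrt P) :: quat)" and "q = of_real (sqrt Q) * qj"
  define v where "v = rscale z p + rscale w q"
  have nq: "(norm p)\<^sup>2 = P" "(norm q)\<^sup>2 = Q"
    using PQ by (simp_all add: p_def q_def norm_quat_mult norm_quat_of_real power_mult_distrib)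
      (simp add: qj_def norm_quat_def inner_quat_def)
  have "(lower_norm \<alpha> \<beta> (gram_of p q))\<^sup>2 = 0"
    unfolding gram_of_def lower_norm_power2[OF zw(4,5)] nq
    using PQ by (simp add: p_def q_def qj_def)
  then have "norm (qIm (form A v v)) = 0"
    unfolding v_def norm_qIm_form_pencil[OF zw] by simp
  moreover have "v \<noteq> 0"
  proof
    assume "v = 0"
    then have "p = 0 \<and> q = 0"
      using rspan2_independent[OF span, of i j] ij unfolding v_def x_def y_def by (auto simp: axis_def)
    then show False using nq PQ by auto
  qed
  then obtain c where "c *\<^sub>R form A v v \<in> numerical_range A"
    by (rule numerical_range_normalize)
  moreover have "qIm (c *\<^sub>R u) = c *\<^sub>R qIm u" for u by (simp add: quat_eq_iff)
  ultimately show ?thesis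
    using that[of "qRe (c *\<^sub>R form A v v)"] mem_numerical_range_iff[of "c *\<^sub>R form A v v" A] by simp
qed

text \<open>
  By polarization, a skew-Hermitian form that vanishes on the diagonal vanishes identically.
\<close>
lemma non_hermitian_imp_nonreal:
  fixes A :: "quat^'n^'n"
  assumes "\<not> hermitian A"
  obtains x r where "(x, r) \<in> upper_bild A" "0 < r"
proof -
  have "\<exists>x. skew_form A x x \<noteq> 0"
  proof (rule ccontr)
    assume "\<not> ?thesis"
    then have zero: "skew_form A x x = 0" for x by blast
    have zero2: "skew_form A x y = 0" for x y
      using skew_form_polarize[of A x y] zero by metis
    have entry: "form A (axis i 1) (axis j 1) = A $ i $ j" for i j
    proof -
      have "(A *v axis j 1) $ k = A $ k $ j" for k
        by (simp add: matrix_vector_mult_def axis_def if_distrib[of "(*) _"] cong: if_cong)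
      then show ?thesis
        by (simp add: form_def star_prod_def axis_def if_distrib[of "\<lambda>u. u * _"] if_distrib[of qcnj] cong: if_cong)
          (simp add: quat_eq_iff)
    qed
    have "A $ i $ j = cadjoint A $ i $ j" for i j
      using zero2[of "axis i 1" "axis j 1"] unfolding skew_form_def entry by (simp add: cadjoint_def)
    then have "hermitian A" unfolding hermitian_def vec_eq_iff by blast
    then show False using assms by simp
  qed
  then obtain x where x: "skew_form A x x \<noteq> 0" by blast
  then have "x \<noteq> 0" using skew_form_simps(3)[of A x x 0] by auto
  then obtain c where c: "c > 0" "c *\<^sub>R form A x x \<in> numerical_range A"
    by (rule numerical_range_normalize)
  have "qIm (form A x x) \<noteq> 0"
    using x by (auto simp: skew_form_def quat_eq_iff)
  then have "qIm (c *\<^sub>R form A x x) \<noteq> 0"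
    using c(1) by (auto simp: quat_eq_iff)
  then show ?thesis
    using that c(2) mem_numerical_range_iff by (metis zero_less_norm_iff)
qed

section \<open>The star-center of the numerical range\<close>

lemma compact_LEAST:
  fixes P :: "real \<Rightarrow> bool"
  assumes "compact {t. P t}" "P t0"
  shows "P (LEAST t. P t)" "\<And>t. P t \<Longrightarrow> (LEAST t. P t) \<le> t"
proof -
  obtain s where s: "P s" "\<And>t. P t \<Longrightarrow> s \<le> t"
    using compact_attains_inf[OF assms(1)] assms(2) by blast
  then have "(LEAST t. P t) = s" by (rule Least_equality)
  with s show "P (LEAST t. P t)" "\<And>t. P t \<Longrightarrow> (LEAST t. P t) \<le> t" by auto
qed

lemma compact_GREATEST:
  fixes P :: "real \<Rightarrow> bool"
  assumes "compact {t. P t}" "P t0"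
  shows "P (GREATEST t. P t)" "\<And>t. P t \<Longrightarrow> t \<le> (GREATEST t. P t)"
proof -
  obtain s where s: "P s" "\<And>t. P t \<Longrightarrow> t \<le> s"
    using compact_attains_sup[OF assms(1)] assms(2) by blast
  then have "(GREATEST t. P t) = s" by (rule Greatest_equality)
  with s show "P (GREATEST t. P t)" "\<And>t. P t \<Longrightarrow> t \<le> (GREATEST t. P t)" by auto
qed

lemma compact_horizontal_slice:
  fixes D :: "(real \<times> real) set"
  assumes "compact D"
  shows "compact {x. (x, r) \<in> D}"
proof -
  have "compact (D \<inter> {p. snd p = r})"
    using assms by (intro compact_Int_closed closed_Collect_eq continuous_intros)
  then have "compact (fst ` (D \<inter> {p. snd p = r}))"
    by (intro compact_continuous_image continuous_intros)
  moreover have "fst ` (D \<inter> {p. snd p = r}) = {x. (x, r) \<in> D}"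
    by force
  ultimately show ?thesis by simp
qed

theorem corollary4p5:
  fixes A :: "quat^'n^'n"
    and W B Bminus l L :: "quat set"
    and m M \<pi>_m \<pi>_M y_m :: real
    and x1 x2 :: "real \<Rightarrow> real"
    and a b :: ereal
    and \<omega> :: quat
  assumes "CARD('n) \<ge> 2"
    and "\<not> hermitian A"
    and "W = numerical_range A"
    and "B = W \<inter> cplane"
    and "Bminus = W \<inter> cplane_lower"
    and "m = (LEAST t. of_real t \<in> W)"
    and "M = (GREATEST t. of_real t \<in> W)"
    and "\<pi>_m = (LEAST t. t \<in> qRe ` W)"
    and "\<pi>_M = (GREATEST t. t \<in> qRe ` W)"
    and "y_m = (LEAST y. \<exists>x. cpt x y \<in> B)"
    and "\<And>y. y \<in> {y_m..0} \<Longrightarrow> x1 y = (LEAST x. cpt x y \<in> Bminus)"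
    and "\<And>y. y \<in> {y_m..0} \<Longrightarrow> x2 y = (GREATEST x. cpt x y \<in> Bminus)"
    and "a = left_deriv x1 0"
    and "b = left_deriv x2 0"
    and "l = cline a m"
    and "L = cline b M"
    and "\<pi>_m < m" and "m \<le> M" and "M < \<pi>_M"
    and "\<omega> \<in> cplane_upper"
    and "l \<inter> L = {\<omega>}"
  shows "star_center W \<inter> cplane = convex hull {cpt m 0, cpt M 0, \<omega>, qcnj \<omega>} \<inter> B"
proof -
  define D where "D = upper_bild A"
  note W = assms(3) and B = assms(4)
  have mem: "w \<in> W \<longleftrightarrow> (qRe w, norm (qIm w)) \<in> D" for w
    by (simp add: W D_def mem_numerical_range_iff)
  have cmem: "cpt x y \<in> W \<longleftrightarrow> (x, \<bar>y\<bar>) \<in> D" for x y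
    by (simp add: W D_def cpt_mem_numerical_range_iff)
  have rmem: "of_real t \<in> W \<longleftrightarrow> (t, 0) \<in> D" for t
    using cmem[of t 0] by (simp add: cpt_def)
  have cD: "compact D" and vD: "convex D"
    by (simp_all add: D_def compact_upper_bild convex_upper_bild)
  have comb: "((1 - u) * x + u * x', (1 - u) * r + u * r') \<in> D"
    if "(x, r) \<in> D" "(x', r') \<in> D" "0 \<le> u" "u \<le> 1" for x r x' r' u
    using convexD_alt[OF vD that] by simp
  have nonneg: "0 \<le> r" if "(x, r) \<in> D" for x r
    using that by (auto simp: D_def upper_bild_def)

  obtain t0 where t0: "(t0, 0) \<in> D"
    using numerical_range_meets_reals[OF assms(1), of A] unfolding D_def by blast
  have cR: "compact {t. (t, 0) \<in> D}" by (rule compact_horizontal_slice[OF cD])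
  have m: "(m, 0) \<in> D" "\<And>t. (t, 0) \<in> D \<Longrightarrow> m \<le> t"
    using compact_LEAST[OF cR t0] unfolding assms(6) rmem by auto
  have M: "(M, 0) \<in> D" "\<And>t. (t, 0) \<in> D \<Longrightarrow> t \<le> M"
    using compact_GREATEST[OF cR t0] unfolding assms(7) rmem by auto
  have real: "(t, 0) \<in> D \<longleftrightarrow> m \<le> t \<and> t \<le> M" for t
  proof
    assume "m \<le> t \<and> t \<le> M"
    then have "t \<in> closed_segment m M" by (simp add: closed_segment_eq_real_ivl)
    then obtain u where "0 \<le> u" "u \<le> 1" "t = (1 - u) * m + u * M"
      by (auto simp: in_segment)
    then show "(t, 0) \<in> D" using comb[OF m(1) M(1), of u] by simp
  qed (use m M in auto)

  obtain R xR where R: "(xR, R) \<in> D" "0 < R" "\<And>x r. (x, r) \<in> D \<Longrightarrow> r \<le> R"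
  proof -
    have "compact (snd ` D)"
      by (intro compact_continuous_image continuous_intros cD)
    moreover have "snd ` D \<noteq> {}" using t0 by blast
    ultimately obtain p where p: "p \<in> D" "\<And>q. q \<in> D \<Longrightarrow> snd q \<le> snd p"
      using compact_attains_sup[of "snd ` D"] by blast
    obtain x r where "(x, r) \<in> D" "0 < r"
      using non_hermitian_imp_nonreal[OF assms(2)] unfolding D_def by blast
    then have "0 < snd p" using p(2) by force
    with p that[of "fst p" "snd p"] show ?thesis by force
  qed
  have "y_m = - R"
    unfolding assms(10)
  proof (rule Least_equality)
    have "cpt xR (- R) \<in> B" using R by (simp add: B cmem cplane_eq, blast)
    then show "\<exists>x. cpt x (- R) \<in> B" by blast
    fix y assume "\<exists>x. cpt x y \<in> B"
    then obtain x where "(x, \<bar>y\<bar>) \<in> D" by (auto simp: B cmem)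
    then show "- R \<le> y" using R(3)[of x "\<bar>y\<bar>"] by simp
  qed
  then have y_m: "y_m < 0" "- y_m = R" using R by auto

  \<comment> \<open>Every height between \<open>0\<close> and \<open>R\<close> is attained on the segment from \<open>(m, 0)\<close> to a highest point.\<close>
  have slice: "\<exists>x. (x, - y) \<in> D" if "y \<in> {y_m..0}" for y
  proof -
    have "(1 - - y / R) * 0 + (- y / R) * R = - y" using R by simp
    then show ?thesis
      using comb[OF m(1) R(1), of "- y / R"] that y_m R(2) by (auto simp: field_simps)
  qed
  have low: "cpt x y \<in> Bminus \<longleftrightarrow> (x, - y) \<in> D" if "y \<in> {y_m..0}" for x y
  proof -
    have "cpt x y \<in> cplane_lower" using that by (auto simp: cplane_lower_def)
    then show ?thesis using that by (simp add: assms(5) cmem)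
  qed
  have x1: "(x1 y, - y) \<in> D" "\<And>x. (x, - y) \<in> D \<Longrightarrow> x1 y \<le> x" if "y \<in> {y_m..0}" for y
    using compact_LEAST[OF compact_horizontal_slice[OF cD, of "- y"]] slice[OF that]
    unfolding assms(11)[OF that] low[OF that] by blast+
  have x2: "(x2 y, - y) \<in> D" "\<And>x. (x, - y) \<in> D \<Longrightarrow> x \<le> x2 y" if "y \<in> {y_m..0}" for y
    using compact_GREATEST[OF compact_horizontal_slice[OF cD, of "- y"]] slice[OF that]
    unfolding assms(12)[OF that] low[OF that] by blast+
  have at0: "x1 0 = m" "x2 0 = M"
    using x1[of 0] x2[of 0] m M y_m by (auto intro: antisym)

  have segm: "((1 - t) * u + t * v) \<in> {y_m..0}" if "u \<in> {y_m..0}" "v \<in> {y_m..0}" "0 < t" "t < 1" for t u v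
    using convexD_alt[OF convex_real_interval(5), of u y_m 0 v t] that by simp
  have conv1: "convex_on {y_m..0} x1"
  proof (rule convex_onI)
    fix t u v :: real assume h: "0 < t" "t < 1" "u \<in> {y_m..0}" "v \<in> {y_m..0}"
    have "((1 - t) * x1 u + t * x1 v, - ((1 - t) * u + t * v)) \<in> D"
      using comb[OF x1(1)[OF h(3)] x1(1)[OF h(4)], of t] h by (simp add: algebra_simps)
    then show "x1 ((1 - t) *\<^sub>R u + t *\<^sub>R v) \<le> (1 - t) * x1 u + t * x1 v"
      using x1(2)[OF segm[OF h(3,4,1,2)]] by simp
  qed simp
  have conv2: "convex_on {y_m..0} (\<lambda>y. - x2 y)"
  proof (rule convex_onI)
    fix t u v :: real assume h: "0 < t" "t < 1" "u \<in> {y_m..0}" "v \<in> {y_m..0}"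
    have "((1 - t) * x2 u + t * x2 v, - ((1 - t) * u + t * v)) \<in> D"
      using comb[OF x2(1)[OF h(3)] x2(1)[OF h(4)], of t] h by (simp add: algebra_simps)
    from x2(2)[OF segm[OF h(3,4,1,2)] this] show "- x2 ((1 - t) *\<^sub>R u + t *\<^sub>R v) \<le> (1 - t) * - x2 u + t * - x2 v"
      by simp
  qed simp
  have a: "a = (SUP y\<in>{y_m..<0}. ereal ((x1 y - m) / y))"
    unfolding assms(13) left_deriv_convex[OF y_m(1) conv1] at0 ..
  have b: "b = (INF y\<in>{y_m..<0}. ereal ((x2 y - M) / y))"
    unfolding assms(14) left_deriv_concave[OF y_m(1) conv2] at0 ..

  have cW: "compact (qRe ` W)"
    unfolding W by (intro compact_continuous_image continuous_on_qRe compact_numerical_range)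
  \<comment> \<open>A point of \<open>D\<close> with abscissa \<open>\<pi>_m < m\<close> forces the left boundary to lean outwards.\<close>
  have "0 < a"
  proof -
    have "\<pi>_m \<in> qRe ` W"
      unfolding assms(8) using compact_LEAST(1)[of "\<lambda>t. t \<in> qRe ` W"] cW rmem t0 by force
    then obtain r where r: "(\<pi>_m, r) \<in> D" using mem by auto
    then have "r \<noteq> 0" using m(2) assms(17) by fastforce
    then have r': "- r \<in> {y_m..<0}" using nonneg[OF r] R(3)[OF r] y_m by auto
    then have "x1 (- r) \<le> \<pi>_m" using x1(2)[of "- r"] r by auto
    then have "0 < (x1 (- r) - m) / (- r)" using r' assms(17) by (simp add: divide_simps)
    also have "ereal ((x1 (- r) - m) / (- r)) \<le> a"
      unfolding a using r' by (rule SUP_upper)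
    finally show ?thesis by (simp add: zero_ereal_def)
  qed
  have "b < 0"
  proof -
    have "\<pi>_M \<in> qRe ` W"
      unfolding assms(9) using compact_GREATEST(1)[of "\<lambda>t. t \<in> qRe ` W"] cW rmem t0 by force
    then obtain r where r: "(\<pi>_M, r) \<in> D" using mem by auto
    then have "r \<noteq> 0" using M(2) assms(19) by fastforce
    then have r': "- r \<in> {y_m..<0}" using nonneg[OF r] R(3)[OF r] y_m by auto
    then have "\<pi>_M \<le> x2 (- r)" using x2(2)[of "- r"] r by auto
    then have neg: "(x2 (- r) - M) / (- r) < 0" using r' assms(19) by (simp add: divide_simps)
    have "b \<le> ereal ((x2 (- r) - M) / (- r))"
      unfolding b using r' by (rule INF_lower)
    also have "\<dots> < 0" using neg by simp
    finally show ?thesis .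
  qed

  have star_iff: "cpt x y \<in> star_center W \<longleftrightarrow> (x, \<bar>y\<bar>) \<in> D \<and>
      (\<forall>(x', r)\<in>D. m * (r + \<bar>y\<bar>) \<le> r * x + \<bar>y\<bar> * x' \<and> r * x + \<bar>y\<bar> * x' \<le> M * (r + \<bar>y\<bar>))"
    for x y
    by (rule star_center_axial_iff[OF mem vD _ real]) (rule nonneg)
  \<comment> \<open>For \<open>y \<noteq> 0\<close> the two inequalities say that \<open>m + a |y| \<le> x \<le> M + b |y|\<close>; in this quotient form they
     make sense for infinite slopes, where they fail.\<close>
  have star: "cpt x y \<in> star_center W \<longleftrightarrow> (x, \<bar>y\<bar>) \<in> D \<and>
      (y \<noteq> 0 \<longrightarrow> a \<le> ereal ((x - m) / \<bar>y\<bar>) \<and> ereal ((x - M) / \<bar>y\<bar>) \<le> b)" for x y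
  proof (cases "y = 0")
    case True
    have "m * r \<le> r * x \<and> r * x \<le> M * r" if "(x, 0) \<in> D" "(x', r) \<in> D" for x' r
      using that nonneg[OF that(2)] real by (simp add: mult.commute[of r] mult_right_mono)
    then show ?thesis
      unfolding star_iff using True by auto
  next
    case False
    have "r \<in> {0..- y_m} \<and> x1 (- r) \<le> x'" "r \<in> {0..- y_m} \<and> x' \<le> x2 (- r)" if "(x', r) \<in> D" for x' r
      using that nonneg[OF that] R(3)[OF that] x1(2)[of "- r"] x2(2)[of "- r"] y_m by auto
    then have
      "(\<forall>(x', r)\<in>D. m * (r + \<bar>y\<bar>) \<le> r * x + \<bar>y\<bar> * x') \<longleftrightarrow> a \<le> ereal ((x - m) / \<bar>y\<bar>)"
      "(\<forall>(x', r)\<in>D. r * x + \<bar>y\<bar> * x' \<le> M * (r + \<bar>y\<bar>)) \<longleftrightarrow> ereal ((x - M) / \<bar>y\<bar>) \<le> b"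
      using support_slope_left_iff[of y_m x1 D y x] support_slope_right_iff[of y_m x2 D y x]
        x1(1) x2(1) False unfolding a b at0 by auto
    then show ?thesis
      unfolding star_iff using False by blast
  qed

  obtain x0 y0 where \<omega>: "\<omega> = cpt x0 y0" "0 \<le> y0"
    using assms(20) by (auto simp: cplane_upper_def)
  have lL: "cpt x0 y0 \<in> cline a m" "cpt x0 y0 \<in> cline b M"
    using assms(15,16,21) \<omega> by auto
  have cpt_inj: "cpt x y = cpt x' y' \<longleftrightarrow> x = x' \<and> y = y'" for x y x' y'
    by (simp add: cpt_eq_Quat)
  have line: "cpt x y \<in> cline c d \<longleftrightarrow> ereal x = c * ereal y + ereal d" for x y c d
    by (auto simp: cline_def cpt_inj)
  show ?thesis
  proof (cases "\<bar>a\<bar> = \<infinity> \<or> \<bar>b\<bar> = \<infinity>")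
    case True
    then have "y0 = 0"
      using lL cline_infinite_slope[of a m] cline_infinite_slope[of b M] by (metis cpt_inj singletonD)
    then have deg: "m = M \<and> x0 = m \<and> y0 = 0"
      using lL unfolding line by (simp flip: zero_ereal_def)
    \<comment> \<open>With an infinite slope the kite degenerates to the single real point \<open>m = M\<close>.\<close>
    have inf: "a = \<infinity> \<or> b = - \<infinity>" using True \<open>0 < a\<close> \<open>b < 0\<close> by (cases a; cases b) auto
    have "cpt x y \<in> star_center W \<longleftrightarrow> x = m \<and> y = 0" for x y
      unfolding star using inf real deg by auto
    then have "star_center W \<inter> cplane = {cpt m 0}"
      by (auto simp: cplane_eq)
    moreover have "cpt m 0 \<in> B" using m(1) by (auto simp: B cmem cplane_eq)
    ultimately show ?thesis using deg by (simp add: \<omega> qcnj_cpt)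
  next
    case False
    then obtain a' b' where ab: "a = ereal a'" "b = ereal b'" by auto
    have sgn: "0 < a'" "b' < 0" using \<open>0 < a\<close> \<open>b < 0\<close> by (simp_all add: ab)
    have tip: "m + a' * y0 = x0" "M + b' * y0 = x0"
      using lL by (simp_all add: line ab)
    have "cpt x y \<in> star_center W \<longleftrightarrow> cpt x y \<in> W \<and> m + a' * \<bar>y\<bar> \<le> x \<and> x \<le> M + b' * \<bar>y\<bar>" for x y
    proof (cases "y = 0")
      case True
      then show ?thesis using real by (simp add: star cmem)
    next
      case False
      then show ?thesis by (auto simp: star cmem ab divide_simps)
    qed
    then show ?thesis
      using convex_hull_kite[OF assms(18) _ _ _ \<omega>(2) tip] sgn
      by (auto simp: \<omega> qcnj_cpt B cplane_eq)
  qed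
qed

end
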